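(* Let $R$ be a commutative unital algebra over a field $k$ of characteristic $0$, let $s\ge 1$, and let $f,g\in R\langle\langle x_1,\dots,x_s\rangle\rangle_1$. For a (non-empty) word $w=(i_1\dots i_m)$ in the alphabet $\{1,\dots,s\}$, with $|w|=m$, the multiplicative free convolution of moments has the following canonical decomposition: $$(f\boxtimes_V g)_w=(f\star_{\mathrm{M},m} g)_w+(f\star_{\mathrm{aM},m} g)_w+(-1)^{|w|-1}\,\mathrm{C}_{|w|-1}\cdot (f\star_{\mathrm{B},m} g)_w+\{\text{mixed terms in } f_u \text{ and } g_v \text{ with } 2\le|u|<|w| \text{ or } 2\le|v|<|w|\},$$ where $\mathrm{C}_n$ denotes the $n$th Catalan number.
   Context: $R\langle\langle x_1,\dots,x_s\rangle\rangle_1$ is the set of formal power series in non-commuting variables $x_1,\dots,x_s$ over $R$ with constant term $1$; $f_w$ denotes the coefficient of $x_w=x_{i_1}\cdots x_{i_m}$ for $w=(i_1\dots i_m)$, and $|w|=m$ is the length of $w$. A series $f$ is identified with the $R$-linear functional on $R\langle x_1,\dots,x_s\rangle$ with $f(x_w)=f_w$, $f(1)=1$. Let $y_1,\dots,y_s$ be a second set of variables, so that $R\langle x_1,\dots,x_s,y_1,\dots,y_s\rangle$ is the free product (amalgamated over the unit) of two copies of $R\langle x_1,\dots,x_s\rangle$, with $f$ living on the $x$-copy and $g$ on the $y$-copy. For an alternating product $a_1a_2\cdots a_n$, with $a_i$ in the algebra with label $\epsilon_i\in\{1,2\}$ ($1$ for the $x$-copy, $2$ for the $y$-copy) and $\epsilon_i\ne\epsilon_{i+1}$,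 the boolean (B), monotone (M), anti-monotone (aM) and free (F) products of $f$ and $g$ are $$f\bullet_{\mathrm B} g(a_1\cdots a_n)=\prod_{i:\epsilon_i=1}f(a_i)\prod_{i:\epsilon_i=2}g(a_i),\qquad f\bullet_{\mathrm M} g(a_1\cdots a_n)=f\Big(\prod_{i:\epsilon_i=1}a_i\Big)\prod_{i:\epsilon_i=2}g(a_i),$$ $$f\bullet_{\mathrm{aM}} g(a_1\cdots a_n)=\prod_{i:\epsilon_i=1}f(a_i)\; g\Big(\prod_{i:\epsilon_i=2}a_i\Big),$$ $$f\bullet_{\mathrm F} g(a_1\cdots a_n)=\sum_{I\subsetneq\{1,\dots,n\}}(-1)^{n-|I|+1}\, f\bullet_{\mathrm F} g\Big(\prod_{i\in I}a_i\Big)\prod_{i\notin I}\varphi_{\epsilon_i}(a_i)\quad\text{(recursively)},$$ with $\varphi_1=f$, $\varphi_2=g$, value $1$ on the empty product, and $f\bullet_{\mathrm F}g=f$ (resp. $g$) on the first (resp. second) algebra; products $\prod_{i\in I}a_i$ are taken in the given order, and consecutive factors from the same algebra are multiplied in it. The multiplicative convolutions are obtained from the co-product $\Delta_m(x_i)=x_iy_i$ (extended multiplicatively; the subscript $m$ in $\Delta_m$ and $\star_{\bullet,m}$ stands for "multiplicative"): for $w=(i_1\dots i_m)$ and $\bullet\in\{\mathrm B,\mathrm M,\mathrm{aM},\mathrm F\}$, $$(f\star_{\bullet,m}g)_w=(f\bullet g)(x_{i_1}y_{i_1}x_{i_2}y_{i_2}\cdots x_{i_m}y_{i_m}),$$ and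 $\boxtimes_V:=\star_{\mathrm F,m}$.
   Formalization: The formal statement assumes |w| ≥ 2 instead of w non-empty: for |w| = 1 all four convolutions equal f_i g_i, C_0 = 1 and there are no mixed terms, so the displayed identity would read f_i g_i = 3 f_i g_i, which is false in general. *)

theory Defs
  imports Complex_Main "HOL-Library.Multiset"
begin

section \<open>Series and alternating factorizations\<close>

text \<open>
  Words over the alphabet \<open>'a\<close> are lists. A series in non-commuting variables indexed by \<open>'a\<close>,
  or equivalently a linear functional on the non-commutative polynomials, is given by its values on
  the basis of words.

  Words in the two sets of variables \<open>x\<^sub>i\<close>, \<open>y\<^sub>i\<close> are words over \<open>'a + 'a\<close>, with \<open>Inl i\<close> for \<open>x\<^sub>i\<close>
  and \<open>Inr i\<close> for \<open>y\<^sub>i\<close>. They form a basis of the free product of the two copies of the polynomial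
  algebra, so that a functional on the free product is a function on these words.
\<close>

definition series1 :: "('a list \<Rightarrow> 'r::comm_ring_1) set" where
  "series1 = {f. f [] = 1}"

text \<open>
  The unique factorization of a word in the \<open>x\<close> and \<open>y\<close> as an alternating product \<open>a\<^sub>1 \<dots> a\<^sub>n\<close> of
  non-empty monomials: the factor \<open>Inl u\<close> is the monomial \<open>x\<^sub>u\<close> (label 1) and \<open>Inr v\<close> is the
  monomial \<open>y\<^sub>v\<close> (label 2).
\<close>

fun factors :: "('a + 'a) list \<Rightarrow> ('a list + 'a list) list" where
  "factors [] = []"
| "factors (Inl i # z) =
    (case factors z of Inl u # as \<Rightarrow> Inl (i # u) # as | as \<Rightarrow> Inl [i] # as)"
| "factors (Inr i # z) =
    (case factors z of Inr v # as \<Rightarrow> Inr (i # v) # as | as \<Rightarrow> Inr [i] # as)"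

fun factor_word :: "'a list + 'a list \<Rightarrow> ('a + 'a) list" where
  "factor_word (Inl u) = map Inl u"
| "factor_word (Inr v) = map Inr v"

definition x_factors :: "('a list + 'a list) list \<Rightarrow> 'a list list" where
  "x_factors as = map projl (filter isl as)"

definition y_factors :: "('a list + 'a list) list \<Rightarrow> 'a list list" where
  "y_factors as = map projr (filter (\<lambda>a. \<not> isl a) as)"

lemma concat_factors: "concat (map factor_word (factors z)) = z"
  by (induction z rule: factors.induct) (auto split: list.splits sum.splits)

lemma factors_nonempty: "a \<in> set (factors z) \<Longrightarrow> factor_word a \<noteq> []"
  by (induction z arbitrary: a rule: factors.induct) (auto split: list.splits sum.splits)

lemma factors_alternating: "successively (\<lambda>a b. isl a \<noteq> isl b) (factors z)"
  by (induction z rule: factors.induct)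
    (auto simp: successively_Cons split: list.splits sum.splits)

section \<open>The four products of functionals\<close>

definition boolean_prod ::
  "('a list \<Rightarrow> 'r) \<Rightarrow> ('a list \<Rightarrow> 'r) \<Rightarrow> ('a + 'a) list \<Rightarrow> 'r::comm_ring_1" where
  "boolean_prod f g z =
    (\<Prod>u\<leftarrow>x_factors (factors z). f u) * (\<Prod>v\<leftarrow>y_factors (factors z). g v)"

definition monotone_prod ::
  "('a list \<Rightarrow> 'r) \<Rightarrow> ('a list \<Rightarrow> 'r) \<Rightarrow> ('a + 'a) list \<Rightarrow> 'r::comm_ring_1" where
  "monotone_prod f g z =
    f (concat (x_factors (factors z))) * (\<Prod>v\<leftarrow>y_factors (factors z). g v)"

definition antimonotone_prod ::
  "('a list \<Rightarrow> 'r) \<Rightarrow> ('a list \<Rightarrow> 'r) \<Rightarrow> ('a + 'a) list \<Rightarrow> 'r::comm_ring_1" where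
  "antimonotone_prod f g z =
    (\<Prod>u\<leftarrow>x_factors (factors z). f u) * g (concat (y_factors (factors z)))"

lemma length_concat_nths_le:
  "length (concat (map h (nths as I))) \<le> length (concat (map h as))"
  by (induction as arbitrary: I) (auto simp: nths_Cons intro: le_trans le_add2)

lemma length_concat_nths_less:
  assumes "\<And>a. a \<in> set as \<Longrightarrow> h a \<noteq> []" "I \<subset> {..<length as}"
  shows "length (concat (map h (nths as I))) < length (concat (map h as))"
proof -
  from assms(2) obtain i where "i < length as" "i \<notin> I" by auto
  with assms(1) show ?thesis
  proof (induction as arbitrary: i I)
    case (Cons a as)
    show ?case
    proof (cases i)
      case 0
      then show ?thesis
        using Cons.prems length_concat_nths_le[of h as "{j. Suc j \<in> I}"]
        by (auto simp: nths_Cons less_Suc_eq_le Suc_le_eq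
            intro: le_less_trans)
    next
      case (Suc j)
      have "length (concat (map h (nths as {j. Suc j \<in> I}))) < length (concat (map h as))"
        using Cons.prems Suc by (intro Cons.IH[of j]) auto
      then show ?thesis by (auto simp: nths_Cons)
    qed
  qed simp
qed

text \<open>
  The factors are indexed from 0 here. The argument of the recursive call is the product, in the
  given order, of the factors \<open>a\<^sub>i\<close> with \<open>i \<in> I\<close>; the call factorizes it anew, which multiplies
  consecutive factors from the same algebra.
\<close>

function free_prod ::
  "('a list \<Rightarrow> 'r) \<Rightarrow> ('a list \<Rightarrow> 'r) \<Rightarrow> ('a + 'a) list \<Rightarrow> 'r::comm_ring_1" where
  "free_prod f g z =
    (let as = factors z; n = length as in
      if n = 0 then 1
      else if n = 1 then case_sum f g (hd as)
      else (\<Sum>I | I \<subset> {..<n}.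
        (- 1) ^ (n - card I + 1) * free_prod f g (concat (map factor_word (nths as I)))
          * (\<Prod>i\<in>{..<n} - I. case_sum f g (as ! i))))"
  by pat_completeness auto
termination
proof (relation "measure (\<lambda>(f, g, z). length z)", goal_cases)
  case (2 f g z as n I)
  have "length (concat (map factor_word (nths (factors z) I)))
      < length (concat (map factor_word (factors z)))"
    using 2 by (intro length_concat_nths_less factors_nonempty) auto
  with 2 show ?case by (simp add: concat_factors)
qed simp

declare free_prod.simps [simp del]

section \<open>Multiplicative convolutions\<close>

definition mult_coproduct :: "'a list \<Rightarrow> ('a + 'a) list" where
  "mult_coproduct w = concat (map (\<lambda>i. [Inl i, Inr i]) w)"

definition boolean_mconv :: "('a list \<Rightarrow> 'r) \<Rightarrow> ('a list \<Rightarrow> 'r) \<Rightarrow> 'a list \<Rightarrow> 'r::comm_ring_1" where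
  "boolean_mconv f g w = boolean_prod f g (mult_coproduct w)"

definition monotone_mconv :: "('a list \<Rightarrow> 'r) \<Rightarrow> ('a list \<Rightarrow> 'r) \<Rightarrow> 'a list \<Rightarrow> 'r::comm_ring_1" where
  "monotone_mconv f g w = monotone_prod f g (mult_coproduct w)"

definition antimonotone_mconv ::
  "('a list \<Rightarrow> 'r) \<Rightarrow> ('a list \<Rightarrow> 'r) \<Rightarrow> 'a list \<Rightarrow> 'r::comm_ring_1" where
  "antimonotone_mconv f g w = antimonotone_prod f g (mult_coproduct w)"

definition free_mconv :: "('a list \<Rightarrow> 'r) \<Rightarrow> ('a list \<Rightarrow> 'r) \<Rightarrow> 'a list \<Rightarrow> 'r::comm_ring_1" where
  "free_mconv f g w = free_prod f g (mult_coproduct w)"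

text \<open>
  On words of length 1 the four convolutions coincide; in particular the free one is not the sum
  of the other three there.
\<close>

lemma mconv_single:
  "boolean_mconv f g [i] = f [i] * g [i]"
  "monotone_mconv f g [i] = f [i] * g [i]"
  "antimonotone_mconv f g [i] = f [i] * g [i]"
  by (simp_all add: boolean_mconv_def monotone_mconv_def antimonotone_mconv_def boolean_prod_def
      monotone_prod_def antimonotone_prod_def mult_coproduct_def x_factors_def y_factors_def)

lemma free_mconv_single: "free_mconv f g [i] = f [i] * g [i]"
proof -
  have subsets: "{I. I \<subset> {0, Suc 0}} = {{}, {0}, {Suc 0}}" by auto
  have sets: "{..<Suc (Suc 0)} = {0, Suc 0}" "{0, Suc 0} - {Suc 0} = {0}" by auto
  show ?thesis
    by (simp add: free_mconv_def mult_coproduct_def free_prod.simps[of f g "[Inl i, Inr i]"]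
        free_prod.simps[of f g "[]"] free_prod.simps[of f g "[Inl i]"]
        free_prod.simps[of f g "[Inr i]"] subsets sets nths_Cons Let_def numeral_2_eq_2)
qed

section \<open>Catalan numbers and mixed terms\<close>

definition catalan :: "nat \<Rightarrow> nat" where
  "catalan n = ((2 * n) choose n) div (n + 1)"

text \<open>
  A pair \<open>(U, V)\<close> of multisets of words stands for the monomial \<open>\<Prod>\<^sub>u f\<^sub>u \<Prod>\<^sub>v g\<^sub>v\<close> in the coefficients
  of two series. For a word \<open>w\<close> of length \<open>m\<close>, the mixed monomials are those containing
  coefficients of both \<open>f\<close> and \<open>g\<close>, all at non-empty words shorter than \<open>w\<close>, and at least one of
  them at a word of length at least 2.
\<close>

definition monomial_value ::
  "('a list \<Rightarrow> 'r) \<Rightarrow> ('a list \<Rightarrow> 'r) \<Rightarrow> 'a list multiset \<times> 'a list multiset \<Rightarrow> 'r::comm_ring_1" where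
  "monomial_value f g = (\<lambda>(U, V). (\<Prod>u\<in>#U. f u) * (\<Prod>v\<in>#V. g v))"

definition mixed_monomials :: "nat \<Rightarrow> ('a list multiset \<times> 'a list multiset) set" where
  "mixed_monomials m =
    {(U, V). U \<noteq> {#} \<and> V \<noteq> {#} \<and>
      (\<forall>u\<in>#U. 1 \<le> length u \<and> length u < m) \<and> (\<forall>v\<in>#V. 1 \<le> length v \<and> length v < m) \<and>
      ((\<exists>u\<in>#U. 2 \<le> length u) \<or> (\<exists>v\<in>#V. 2 \<le> length v))}"

end

theory Submission
  imports Defs "HOL-Library.Poly_Mapping" "HOL-Library.Product_Plus"
begin

text \<open>
  Replace \<open>f\<close> and \<open>g\<close> by families of independent variables, so that the free convolution becomes an
  integer polynomial that is homogeneous of degree \<open>|w|\<close> in the \<open>x\<close>-letters and in the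
  \<open>y\<close>-letters. Hence a monomial that is not mixed has a single factor \<open>f\<^sub>w\<close>, or a single factor
  \<open>g\<^sub>w\<close>, or only factors at single letters. Each of the three cases is settled by running the
  recursion modulo a monomial ideal.

  Modulo products of two values of \<open>f\<close>, the free and the monotone product agree on words that begin
  or end with an \<open>x\<close>; exchanging the two algebras gives the anti-monotone product. Modulo all values
  at words of length at least 2, the free product of a word is a multiple of the product of its
  letters. The coefficient vanishes if two consecutive letters have the same label, and the recursion
  for alternating words becomes a signed count of alternating subsequences, solved by the Catalan
  numbers by means of \<open>\<Sum>\<^sub>j (-1)\<^sup>j C\<^sub>j binom(p + j + 1, 2j + 2) = p\<close>.
\<close>

section \<open>Sums over subsequences and the free recursion\<close>

text \<open>Pairs of kept and removed subsequence. Structural recursion replaces sums over index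
  sets by list inductions, and a list of pairs counts positions, so equal factors at different
  places stay separate.\<close>

fun splits :: "'b list \<Rightarrow> ('b list \<times> 'b list) list" where
  "splits [] = [([], [])]"
| "splits (a # as) =
    map (\<lambda>(b, d). (a # b, d)) (splits as) @ map (\<lambda>(b, d). (b, a # d)) (splits as)"

lemma splits_mset: "(b, d) \<in> set (splits as) \<Longrightarrow> mset b + mset d = mset as"
  by (induction as arbitrary: b d) auto

lemma splits_prod_list:
  fixes h :: "'b \<Rightarrow> 'r::comm_ring_1"
  shows "(b, d) \<in> set (splits as) \<Longrightarrow> prod_list (map h b) * prod_list (map h d) = prod_list (map h as)"
  by (induction as arbitrary: b d) (auto simp: algebra_simps)

lemma splits_set: "(b, d) \<in> set (splits as) \<Longrightarrow> set b \<union> set d = set as"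
  by (metis set_mset_mset set_mset_union splits_mset)

lemma splits_map: "splits (map h as) = map (map_prod (map h) (map h)) (splits as)"
  by (induction as) (auto simp: case_prod_unfold)

text \<open>The trivial split comes first, so \<open>tl\<close> leaves the proper subsets of
  positions, over which the free recursion sums.\<close>

lemma splits_hd_tl: "splits as = (as, []) # tl (splits as)"
proof -
  have "splits as \<noteq> [] \<and> hd (splits as) = (as, [])"
    by (induction as) (auto simp: hd_append hd_map)
  then show ?thesis by (metis list.collapse)
qed

lemma tl_splits_nonempty: "(b, d) \<in> set (tl (splits as)) \<Longrightarrow> d \<noteq> []"
proof (induction as arbitrary: b d)
  case (Cons a as)
  have "tl (splits (a # as)) =
      map (\<lambda>(b, d). (a # b, d)) (tl (splits as)) @ map (\<lambda>(b, d). (b, a # d)) (splits as)"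
    by (subst splits.simps, subst splits_hd_tl[of as]) simp
  then show ?case using Cons by auto
qed simp

lemma tl_splits_subset: "set (tl (splits as)) \<subseteq> set (splits as)"
  by (subst (2) splits_hd_tl) auto

text \<open>Bridge to the index sets of \<open>free_prod\<close>: a set of positions of
  \<open>a # as\<close> contains 0 or not, and its remaining part is a shifted set of positions of
  \<open>as\<close>.\<close>

lemma sum_splits_eq_sum_Pow:
  fixes h :: "_ \<Rightarrow> _ \<Rightarrow> 'r::comm_ring_1"
  shows "(\<Sum>(b, d)\<leftarrow>splits as. h b d) = (\<Sum>I\<in>Pow {..<length as}. h (nths as I) (nths as (- I)))"
proof (induction as arbitrary: h)
  case (Cons a as)
  let ?P = "Pow {..<length as}"
  have Pow: "Pow {..<length (a # as)} = insert 0 ` (`) Suc ` ?P \<union> (`) Suc ` ?P"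
    by (simp add: lessThan_Suc_eq_insert_0 Pow_insert image_Pow_surj Un_commute del: image_image)
  have inj2: "inj_on ((`) Suc) ?P" by (simp add: inj_on_def inj_image_eq_iff)
  have "inj_on (insert 0) ((`) Suc ` ?P)"
    by (rule inj_onI) (metis (no_types, lifting) imageE insert_ident nat.distinct(1))
  with inj2 have inj1: "inj_on (insert 0 \<circ> (`) Suc) ?P" by (rule comp_inj_on)
  have "(\<Sum>I\<in>Pow {..<length (a # as)}. h (nths (a # as) I) (nths (a # as) (- I)))
    = (\<Sum>I\<in>(insert 0 \<circ> (`) Suc) ` ?P. h (nths (a # as) I) (nths (a # as) (- I)))
      + (\<Sum>I\<in>(`) Suc ` ?P. h (nths (a # as) I) (nths (a # as) (- I)))"
    unfolding Pow image_comp[symmetric] by (rule sum.union_disjoint) auto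
  also have "\<dots> = (\<Sum>I\<in>?P. h (a # nths as I) (nths as (- I)))
      + (\<Sum>I\<in>?P. h (nths as I) (a # nths as (- I)))"
    unfolding sum.reindex[OF inj1] sum.reindex[OF inj2]
    by (simp add: nths_Cons Compl_eq inj_image_mem_iff image_iff)
  also have "\<dots> = (\<Sum>(b, d)\<leftarrow>splits (a # as). h b d)"
    using Cons.IH[of "\<lambda>b d. h (a # b) d"] Cons.IH[of "\<lambda>b d. h b (a # d)"]
    by (simp add: case_prod_unfold comp_def)
  finally show ?case by simp
qed simp

lemma prod_list_nths:
  fixes h :: "_ \<Rightarrow> 'r::comm_ring_1"
  shows "prod_list (map h (nths as I)) = (\<Prod>i\<in>{..<length as} \<inter> I. h (as ! i))"
proof (induction as rule: rev_induct)
  case (snoc a as)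
  have "{..<length (as @ [a])} \<inter> I
      = (if length as \<in> I then insert (length as) ({..<length as} \<inter> I) else {..<length as} \<inter> I)"
    by (auto simp: less_Suc_eq)
  moreover have "(\<Prod>i\<in>{..<length as} \<inter> I. h ((as @ [a]) ! i)) = (\<Prod>i\<in>{..<length as} \<inter> I. h (as ! i))"
    by (intro prod.cong) (auto simp: nth_append)
  ultimately show ?case using snoc by (simp add: nths_append mult.commute)
qed simp

abbreviation word :: "('a list + 'a list) list \<Rightarrow> ('a + 'a) list" where
  "word as \<equiv> concat (map factor_word as)"

lemma length_word_split:
  "(b, d) \<in> set (splits as) \<Longrightarrow> length (word b) + length (word d) = length (word as)"
proof (induction as arbitrary: b d)
qed auto

text \<open>A proper split removes a factor, and factors are non-empty. This decrease drives the
  later inductions on the length of a word.\<close>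

lemma length_word_tl_split:
  assumes "(b, d) \<in> set (tl (splits (factors z)))"
  shows "length (word b) < length z"
proof -
  have "d \<noteq> []" and bd: "(b, d) \<in> set (splits (factors z))"
    using assms tl_splits_nonempty tl_splits_subset by blast+
  then have "word d \<noteq> []"
    using factors_nonempty[of _ z] splits_set[OF bd] by (cases d) auto
  then show ?thesis
    using length_word_split[OF bd] by (simp add: concat_factors del: concat_eq_Nil_conv flip: length_greater_0_conv)
qed

lemma free_prod_Nil: "free_prod f g [] = 1"
  by (simp add: free_prod.simps)

lemma free_prod_factor: "factors z = [a] \<Longrightarrow> free_prod f g z = case_sum f g a"
  by (simp add: free_prod.simps)

text \<open>This is the vanishing of the free product on the alternating product of the centred elements
  \<open>a\<^sub>i - \<phi>(a\<^sub>i)\<close>.\<close>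

lemma free_prod_sum_splits:
  fixes f g :: "'a list \<Rightarrow> 'r::comm_ring_1"
  assumes "2 \<le> length (factors z)"
  shows "(\<Sum>(b, d)\<leftarrow>splits (factors z).
    (- 1) ^ length b * (free_prod f g (word b) * prod_list (map (case_sum f g) d))) = 0"
proof -
  define as n where "as = factors z" and "n = length as"
  define W where "W I = (- 1) ^ card I * (free_prod f g (word (nths as I))
    * (\<Prod>i\<in>{..<n} - I. case_sum f g (as ! i)))" for I
  have "factors z \<noteq> []" using assms by auto
  then have "free_prod f g z = (\<Sum>I | I \<subset> {..<n}. (- 1) ^ (n - card I + 1) *
      free_prod f g (word (nths as I)) * (\<Prod>i\<in>{..<n} - I. case_sum f g (as ! i)))"
    using assms by (subst free_prod.simps) (simp add: Let_def as_def n_def)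
  also have "\<dots> = (\<Sum>I | I \<subset> {..<n}. (- 1) ^ Suc n * W I)"
  proof (rule sum.cong)
    fix I assume "I \<in> {I. I \<subset> {..<n}}"
    then have "card I \<le> n" using card_mono[of "{..<n}" I] by auto
    then have "(- 1 :: 'r) ^ (n - card I + 1) = (- 1) ^ Suc n * (- 1) ^ card I"
      by (simp add: minus_one_power_iff)
    then show "(- 1) ^ (n - card I + 1) * free_prod f g (word (nths as I))
        * (\<Prod>i\<in>{..<n} - I. case_sum f g (as ! i)) = (- 1) ^ Suc n * W I"
      by (simp add: W_def mult.assoc)
  qed simp
  also have "\<dots> = (- 1) ^ Suc n * (\<Sum>I | I \<subset> {..<n}. W I)"
    by (simp add: sum_distrib_left)
  finally have rec: "free_prod f g z = (- 1) ^ Suc n * (\<Sum>I | I \<subset> {..<n}. W I)" .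
  \<comment> \<open>Keeping every factor gives back \<open>z\<close>, so by the recursion this term
    cancels all the others.\<close>
  have "W {..<n} = (- 1) ^ n * free_prod f g z"
    by (simp add: W_def n_def as_def concat_factors)
  then have "W {..<n} = - (\<Sum>I | I \<subset> {..<n}. W I)"
    by (simp add: rec mult.assoc[symmetric] power_mult_distrib[symmetric])
  moreover have "Pow {..<n} = insert {..<n} {I. I \<subset> {..<n}}" by auto
  moreover have "finite {I. I \<subset> {..<n}}"
    by (rule finite_subset[of _ "Pow {..<n}"]) auto
  ultimately have "(\<Sum>I\<in>Pow {..<n}. W I) = 0" by simp
  moreover have "W I = (- 1) ^ length (nths as I) * (free_prod f g (word (nths as I))
      * prod_list (map (case_sum f g) (nths as (- I))))" if "I \<in> Pow {..<n}" for I
  proof -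
    have "{i. i < n \<and> i \<in> I} = I" "{..<n} \<inter> - I = {..<n} - I" using that by auto
    then show ?thesis by (simp add: W_def length_nths prod_list_nths n_def)
  qed
  ultimately show ?thesis
    by (simp add: sum_splits_eq_sum_Pow as_def[symmetric] n_def[symmetric])
qed

text \<open>The sign of the term with nothing removed is its own inverse. \<open>X\<close> is
  arbitrary because the identity serves both the free product and its candidate value
  \<open>single_letter_term\<close>.\<close>

lemma sum_splits_solve:
  fixes X :: "_ \<Rightarrow> 'r::comm_ring_1"
  assumes "(\<Sum>(b, d)\<leftarrow>splits as. (- 1) ^ length b * (X b * prod_list (map h d))) = 0"
  shows "X as = (- 1) ^ Suc (length as) *
    (\<Sum>(b, d)\<leftarrow>tl (splits as). (- 1) ^ length b * (X b * prod_list (map h d)))" (is "_ = _ * ?S")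
proof -
  let ?s = "(- 1) ^ length as :: 'r"
  have "?s * X as + ?S = 0"
    using assms by (subst (asm) splits_hd_tl) simp
  then have "?s * X as = - ?S" by (simp add: eq_neg_iff_add_eq_0)
  have "X as = ?s * (?s * X as)"
    by (simp add: power_mult_distrib[symmetric] mult.assoc[symmetric])
  also have "\<dots> = ?s * - ?S" by (subst \<open>?s * X as = - ?S\<close>) simp
  finally show ?thesis by simp
qed

lemma free_prod_rec:
  assumes "2 \<le> length (factors z)"
  shows "free_prod f g z = (- 1) ^ Suc (length (factors z)) * (\<Sum>(b, d)\<leftarrow>tl (splits (factors z)).
    (- 1) ^ length b * (free_prod f g (word b) * prod_list (map (case_sum f g) d)))"
  using sum_splits_solve[OF free_prod_sum_splits[OF assms, of f g]] by (simp add: concat_factors)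

section \<open>Reduction to the monotone product\<close>

lemma prod_list_factor:
  fixes h :: "_ \<Rightarrow> 'r::comm_ring_1"
  assumes "a \<in> set as"
  obtains r where "prod_list (map h as) = h a * r"
proof -
  obtain bs cs where "as = bs @ a # cs" using assms by (meson split_list)
  then have "prod_list (map h as) = h a * (prod_list (map h bs) * prod_list (map h cs))"
    by (simp add: ac_simps)
  then show thesis by (rule that)
qed

text \<open>Congruence modulo \<open>J\<close> is expressed as membership of a difference.
  \<open>J\<close> will be spanned by monomials in generic coefficients.\<close>

locale ring_ideal =
  fixes J :: "'r::comm_ring_1 set"
  assumes zero_mem: "0 \<in> J"
    and add_mem: "x \<in> J \<Longrightarrow> y \<in> J \<Longrightarrow> x + y \<in> J"
    and mult_mem: "x \<in> J \<Longrightarrow> r * x \<in> J"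
begin

lemma mult_mem_right: "x \<in> J \<Longrightarrow> x * r \<in> J"
  using mult_mem[of x r] by (simp add: mult.commute)

lemma minus_mem: "x \<in> J \<Longrightarrow> - x \<in> J"
  using mult_mem[of x "- 1"] by simp

lemma diff_mem: "x \<in> J \<Longrightarrow> y \<in> J \<Longrightarrow> x - y \<in> J"
  using add_mem[of x "- y"] minus_mem by simp

lemma sum_list_mem: "(\<And>x. x \<in> set xs \<Longrightarrow> h x \<in> J) \<Longrightarrow> (\<Sum>x\<leftarrow>xs. h x) \<in> J"
  by (induction xs) (auto simp: zero_mem add_mem)

lemma prod_list_mem: "a \<in> set as \<Longrightarrow> h a \<in> J \<Longrightarrow> prod_list (map h as) \<in> J"
  by (induction as) (auto simp: mult_mem mult_mem_right)

lemma prod_list_mem2: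
  assumes "\<And>a b. P a \<Longrightarrow> P b \<Longrightarrow> a \<in> set as \<Longrightarrow> b \<in> set as \<Longrightarrow> h a * h b \<in> J"
    and "2 \<le> length (filter P as)"
  shows "prod_list (map h as) \<in> J"
  using assms
proof (induction as)
  case (Cons a as)
  show ?case
  proof (cases "P a \<and> filter P as \<noteq> []")
    case True
    then obtain b where b: "b \<in> set as" "P b" by (auto simp: filter_empty_conv)
    from b(1) obtain r where "prod_list (map h as) = h b * r" by (rule prod_list_factor)
    moreover have "h a * h b \<in> J" using True b by (intro Cons.prems(1)) auto
    ultimately show ?thesis by (simp add: mult.assoc[symmetric] mult_mem_right)
  next
    case False
    with Cons.prems(2) have "2 \<le> length (filter P as)" by (auto split: if_splits)
    then have "prod_list (map h as) \<in> J" by (intro Cons.IH Cons.prems(1)) auto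
    then show ?thesis by (simp add: mult_mem)
  qed
qed simp

text \<open>Some factor of the word has label 1. In each term of the recursion it is either kept,
  and the induction hypothesis applies, or removed, and then it contributes a value of
  \<open>f\<close> that meets \<open>f u\<close>.\<close>

lemma free_prod_mult_mem:
  assumes ff: "\<And>u v. u \<noteq> [] \<Longrightarrow> v \<noteq> [] \<Longrightarrow> f u * f v \<in> J"
    and "Inl i \<in> set z" "u \<noteq> []"
  shows "free_prod f g z * f u \<in> J"
  using \<open>Inl i \<in> set z\<close>
proof (induction "length z" arbitrary: z i rule: less_induct)
  case less
  define as where "as = factors z"
  have nonempty: "v \<noteq> []" if "Inl v \<in> set as" for v
    using factors_nonempty[of "Inl v" z] that by (auto simp: as_def)
  have "Inl i \<in> set (word as)" using less.prems by (simp add: as_def concat_factors)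
  then obtain a where "a \<in> set as" "Inl i \<in> set (factor_word a)" by auto
  then obtain v where v: "Inl v \<in> set as" by - (cases a; auto)
  consider "as = [Inl v]" | "2 \<le> length as"
    using v by (cases as rule: remdups_adj.cases) auto
  then show ?case
  proof cases
    case 1
    then show ?thesis
      using ff[OF nonempty[OF v] \<open>u \<noteq> []\<close>] by (simp add: as_def free_prod_factor)
  next
    case 2
    have "free_prod f g (word b) * prod_list (map (case_sum f g) d) * f u \<in> J"
      if bd: "(b, d) \<in> set (tl (splits as))" for b d
    proof -
      have "Inl v \<in> set b \<union> set d"
        using v splits_set[of b d as] bd tl_splits_subset[of as] by blast
      then show ?thesis
      proof
        assume "Inl v \<in> set b"
        moreover obtain j where "j \<in> set v" using nonempty[OF v] by (cases v) auto
        ultimately have "Inl j \<in> set (word b)" by force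
        with less.hyps length_word_tl_split bd have "free_prod f g (word b) * f u \<in> J"
          unfolding as_def by blast
        then have "prod_list (map (case_sum f g) d) * (free_prod f g (word b) * f u) \<in> J"
          by (rule mult_mem)
        then show ?thesis by (simp add: ac_simps)
      next
        assume "Inl v \<in> set d"
        then obtain r where "prod_list (map (case_sum f g) d) = f v * r"
          using prod_list_factor[of "Inl v" d "case_sum f g"] by auto
        then have "free_prod f g (word b) * prod_list (map (case_sum f g) d) * f u
            = free_prod f g (word b) * r * (f v * f u)" by (simp add: algebra_simps)
        then show ?thesis using mult_mem[OF ff[OF nonempty[OF v] \<open>u \<noteq> []\<close>]] by simp
      qed
    qed
    then have "(- 1) ^ length b * (free_prod f g (word b) * prod_list (map (case_sum f g) d)) * f u \<in> J"
      if "(b, d) \<in> set (tl (splits as))" for b d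
      using that mult_mem by (simp add: mult.assoc)
    then have "(\<Sum>(b, d)\<leftarrow>tl (splits as). (- 1) ^ length b *
        (free_prod f g (word b) * prod_list (map (case_sum f g) d))) * f u \<in> J"
      unfolding sum_list_mult_const[symmetric] by (intro sum_list_mem) auto
    then show ?thesis
      using free_prod_rec[of z f g] 2 by (simp add: as_def mult.assoc mult_mem minus_mem)
  qed
qed

end

section \<open>Factorization of a word after removal of y-factors\<close>

lemma factors_append_y:
  "z = [] \<or> isl (hd z) \<Longrightarrow> v \<noteq> [] \<Longrightarrow> factors (map Inr v @ z) = Inr v # factors z"
proof (induction v)
  case (Cons i v)
  have "factors z = [] \<or> isl (hd (factors z))"
    using Cons.prems(1) by (induction z rule: factors.induct) (auto split: list.splits sum.splits)
  then show ?case
    using Cons by (cases "v = []") (auto split: list.splits sum.splits)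
qed simp

lemma factors_factor_word: "factor_word a \<noteq> [] \<Longrightarrow> factors (factor_word a) = [a]"
proof (cases a)
  case (Inl u)
  have "u \<noteq> [] \<Longrightarrow> factors (map Inl u) = [Inl u]" by (induction u rule: list_nonempty_induct) auto
  then show "factor_word a \<noteq> [] \<Longrightarrow> ?thesis" using Inl by simp
qed (use factors_append_y[of "[]"] in simp)

lemma y_factors_factors_append_x: "y_factors (factors (map Inl u @ z)) = y_factors (factors z)"
  by (induction u) (auto simp: y_factors_def split: list.splits sum.splits)

text \<open>Factorizing anew merges only neighbours with the same label. Merged x-factors leave the
  y-factors alone, so only adjacent y-factors have to be excluded.\<close>

lemma y_factors_factors_word:
  assumes "successively (\<lambda>a b. isl a \<or> isl b) as" "\<And>a. a \<in> set as \<Longrightarrow> factor_word a \<noteq> []"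
  shows "y_factors (factors (word as)) = y_factors as"
  using assms
proof (induction as)
  case (Cons a as)
  then have IH: "y_factors (factors (word as)) = y_factors as"
    by (auto simp: successively_Cons)
  show ?case
  proof (cases a)
    case (Inl u)
    then show ?thesis
      using IH by (simp add: y_factors_factors_append_x) (simp add: y_factors_def)
  next
    case (Inr v)
    have "word as = [] \<or> isl (hd (word as))"
    proof (cases as)
      case (Cons a' as')
      with Inr Cons.prems(1) obtain u where "a' = Inl u"
        by (cases a') (auto simp: successively_Cons)
      moreover have "u \<noteq> []" using Cons.prems(2)[of a'] Cons calculation by auto
      ultimately show ?thesis using Cons by (cases u) auto
    qed simp
    with Inr Cons.prems(2)[of a] IH show ?thesis
      by (simp add: factors_append_y) (simp add: y_factors_def)
  qed
qed (simp add: y_factors_def)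

lemma concat_x_factors_factors: "concat (x_factors (factors z)) = map projl (filter isl z)"
  by (induction z rule: factors.induct) (auto simp: x_factors_def split: list.splits sum.splits)

lemma splits_filter_isl:
  "(b, d) \<in> set (splits as) \<Longrightarrow> \<forall>a\<in>set d. \<not> isl a \<Longrightarrow> filter isl b = filter isl as"
  by (induction as arbitrary: b d) auto

lemma filter_isl_word: "map projl (filter isl (word as)) = concat (x_factors as)"
proof (induction as)
  case (Cons a as)
  then show ?case by (cases a) (auto simp: x_factors_def filter_map comp_def)
qed (simp add: x_factors_def)

lemma splits_prod_y_factors:
  fixes f g :: "_ \<Rightarrow> 'r::comm_ring_1"
  shows "(b, d) \<in> set (splits as) \<Longrightarrow> \<forall>a\<in>set d. \<not> isl a \<Longrightarrow>
    prod_list (map g (y_factors b)) * prod_list (map (case_sum f g) d) = prod_list (map g (y_factors as))"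
proof (induction as arbitrary: b d)
  case (Cons a as)
  then show ?case
    by (cases a) (auto simp: y_factors_def mult.assoc algebra_simps)
qed (simp add: y_factors_def)

text \<open>Removing y-factors from an alternating list brings only x-factors together. The second
  conjunct carries the induction: after a kept y-factor comes an x-factor, which is kept as
  well.\<close>

lemma splits_successively:
  assumes "(b, d) \<in> set (splits as)" "\<forall>a\<in>set d. \<not> isl a"
    and "successively (\<lambda>a b. isl a \<noteq> isl b) as"
  shows "successively (\<lambda>a b. isl a \<or> isl b) b \<and> (as \<noteq> [] \<and> isl (hd as) \<longrightarrow> b \<noteq> [] \<and> isl (hd b))"
  using assms
proof (induction as arbitrary: b d)
  case (Cons a as)
  then show ?case
    by (fastforce simp: successively_Cons)
qed simp

lemma splits_last:
  assumes "(b, d) \<in> set (splits as)" "\<forall>a\<in>set d. \<not> isl a" "as \<noteq> []" "isl (last as)"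
  shows "b \<noteq> [] \<and> isl (last b)"
  using assms
proof (induction as arbitrary: b d)
  case (Cons a as)
  show ?case
  proof (cases "as = []")
    case False
    then show ?thesis using Cons by (auto; blast)
  qed (use Cons in auto)
qed simp

lemma hd_word: "as \<noteq> [] \<Longrightarrow> factor_word (hd as) \<noteq> [] \<Longrightarrow> isl (hd (word as)) = isl (hd as)"
proof (cases as)
  case (Cons a as')
  then show "as \<noteq> [] \<Longrightarrow> factor_word (hd as) \<noteq> [] \<Longrightarrow> ?thesis"
    by (cases a) (auto simp: hd_append hd_map)
qed simp

lemma last_word: "as \<noteq> [] \<Longrightarrow> factor_word (last as) \<noteq> [] \<Longrightarrow> isl (last (word as)) = isl (last as)"
proof (cases as rule: rev_cases)
  case (snoc as' a)
  then show "as \<noteq> [] \<Longrightarrow> factor_word (last as) \<noteq> [] \<Longrightarrow> ?thesis"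
    by (cases a) (auto simp: last_append last_map)
qed simp

text \<open>An element satisfying \<open>P\<close> may be kept or removed, with opposite signs. If
  there is none, only the empty removal counts.\<close>

lemma sum_splits_sign:
  "(\<Sum>(b, d)\<leftarrow>splits as. if \<forall>a\<in>set d. P a then (- 1) ^ length b else (0::'r::comm_ring_1))
    = (if \<exists>a\<in>set as. P a then 0 else (- 1) ^ length as)"
proof (induction as)
  case (Cons a as)
  let ?s = "\<lambda>as. \<Sum>(b, d)\<leftarrow>splits as. if \<forall>a\<in>set d. P a then (- 1) ^ length b else (0::'r)"
  have "(\<Sum>(b, d)\<leftarrow>splits as. if \<forall>a\<in>set d. P a then (- 1) ^ Suc (length b) else (0::'r)) = - ?s as"
    unfolding case_prod_unfold uminus_sum_list_map
    by (intro arg_cong[of _ _ sum_list] map_cong) auto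
  then have "?s (a # as) = - ?s as + (if P a then ?s as else 0)"
    by (simp add: case_prod_unfold comp_def if_distrib cong: if_cong)
  then show ?case using Cons by auto
qed simp

context ring_ideal
begin

text \<open>If products of two values of \<open>f\<close> vanish, only those terms of the recursion survive that keep
  all the factors in \<open>x\<close>, and these are equal up to sign.\<close>

lemma free_prod_monotone_mem:
  assumes ff: "\<And>u v. u \<noteq> [] \<Longrightarrow> v \<noteq> [] \<Longrightarrow> f u * f v \<in> J"
    and "z \<noteq> []" "isl (hd z) \<or> isl (last z)"
  shows "free_prod f g z - monotone_prod f g z \<in> J"
  using assms(2,3)
proof (induction "length z" arbitrary: z rule: less_induct)
  case less
  define as where "as = factors z"
  have wa: "word as = z" by (simp add: as_def concat_factors)
  then have as_ne: "as \<noteq> []" using less.prems by auto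
  have nonempty: "factor_word a \<noteq> []" if "a \<in> set as" for a
    using factors_nonempty[of a z] that by (simp add: as_def)
  have alt: "successively (\<lambda>a b. isl a \<noteq> isl b) as"
    unfolding as_def by (rule factors_alternating)
  have hl: "isl (hd as) \<or> isl (last as)"
    using less.prems hd_word[of as] last_word[of as] as_ne nonempty wa by auto
  have mono: "monotone_prod f g z = f (concat (x_factors as)) * prod_list (map g (y_factors as))"
    by (simp add: monotone_prod_def as_def)
  \<comment> \<open>The general case wants two x-factors, so that removing all of them yields two
    values of \<open>f\<close>. By alternation, a list of length at least 3 has them in first and
    third place, or in second and last place if it starts with y.\<close>
  consider a where "as = [a]" | a b where "as = [a, b]" | "2 \<le> length (filter isl as)"
  proof -
    assume *: "\<And>a. as = [a] \<Longrightarrow> thesis" "\<And>a b. as = [a, b] \<Longrightarrow> thesis"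
      "2 \<le> length (filter isl as) \<Longrightarrow> thesis"
    obtain a as1 where a: "as = a # as1" using as_ne by (cases as) auto
    show thesis
    proof (cases as1)
      case Nil then show thesis using *(1) a by simp
    next
      case as1: (Cons b as2)
      show thesis
      proof (cases as2)
        case Nil then show thesis using *(2) a as1 by simp
      next
        case as2: (Cons c as3)
        have "2 \<le> length (filter isl as)"
        proof (cases "isl a")
          case True
          then show ?thesis using alt a as1 as2 by (auto simp: successively_Cons)
        next
          case False
          then have "isl b" "isl (last as2)" using alt hl a as1 as2 by (auto simp: successively_Cons)
          moreover have "last as2 \<in> set as2" using as2 by simp
          ultimately have "filter isl as2 \<noteq> []" by (auto simp: filter_empty_conv)
          then show ?thesis using \<open>isl b\<close> a as1 by (cases "filter isl as2") auto
        qed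
        then show thesis by (rule *(3))
      qed
    qed
  qed
  then show ?case
  proof cases
    case 1
    with hl obtain u where "as = [Inl u]" by (cases a) auto
    then show ?thesis
      using mono by (simp add: as_def free_prod_factor zero_mem x_factors_def y_factors_def)
  next
    case 2
    have [simp]: "factors (factor_word a) = [a]" "factors (factor_word b) = [b]"
      using nonempty 2 by (auto intro: factors_factor_word)
    have "free_prod f g z = case_sum f g a * case_sum f g b"
      using free_prod_rec[of z f g] 2
      by (simp add: as_def free_prod_factor free_prod_Nil algebra_simps)
    then show ?thesis
      using mono 2 alt by (cases a; cases b) (simp_all add: x_factors_def y_factors_def zero_mem mult.commute)
  next
    case 3
    define M where "M = monotone_prod f g z"
    have len: "2 \<le> length as" using 3 le_trans length_filter_le by blast
    define X where "X b = free_prod f g (word b)" for b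
    \<comment> \<open>If only y-factors are removed, the monotone product of the kept word and the
      removed values recombine to \<open>M\<close>; if an x-factor is removed, two values of
      \<open>f\<close> meet.\<close>
    have summand: "X b * prod_list (map (case_sum f g) d) - (if \<forall>a\<in>set d. \<not> isl a then M else 0) \<in> J"
      if bd': "(b, d) \<in> set (tl (splits as))" for b d
    proof -
      have bd: "(b, d) \<in> set (splits as)" using bd' tl_splits_subset by blast
      have sets: "set b \<union> set d = set as" by (rule splits_set[OF bd])
      show ?thesis
      proof (cases "\<forall>a\<in>set d. \<not> isl a")
        case True
        note b = splits_successively[OF bd True alt] splits_last[OF bd True as_ne]
        have "b \<noteq> []" "isl (hd b) \<or> isl (last b)" using b hl as_ne by auto
        moreover have ne: "factor_word a \<noteq> []" if "a \<in> set b" for a using nonempty sets that by auto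
        ultimately have "word b \<noteq> []" "isl (hd (word b)) \<or> isl (last (word b))"
          using hd_word[of b] last_word[of b] by (auto simp: neq_Nil_conv)
        then have "X b - monotone_prod f g (word b) \<in> J"
          unfolding X_def using less.hyps length_word_tl_split bd' unfolding as_def by blast
        then have "(X b - monotone_prod f g (word b)) * prod_list (map (case_sum f g) d) \<in> J"
          by (rule mult_mem_right)
        moreover have "monotone_prod f g (word b) * prod_list (map (case_sum f g) d) = M"
        proof -
          have "y_factors (factors (word b)) = y_factors b"
            using b ne by (intro y_factors_factors_word) auto
          moreover have "concat (x_factors (factors (word b))) = concat (x_factors as)"
            unfolding concat_x_factors_factors filter_isl_word
            by (simp add: x_factors_def splits_filter_isl[OF bd True])
          ultimately show ?thesis
            using splits_prod_y_factors[OF bd True, of g f]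
            by (simp add: M_def monotone_prod_def as_def[symmetric] mult.assoc)
        qed
        ultimately show ?thesis using True by (simp add: algebra_simps)
      next
        case False
        then obtain v where v: "Inl v \<in> set d" by (metis isl_def)
        then have "v \<noteq> []" using nonempty[of "Inl v"] sets by auto
        have "X b * prod_list (map (case_sum f g) d) \<in> J"
        \<comment> \<open>The second value of \<open>f\<close> comes from the recursive call if an
          x-factor is kept, and otherwise from another removed x-factor.\<close>
        proof (cases "\<exists>a\<in>set b. isl a")
          case True
          then obtain u where u: "Inl u \<in> set b" by (metis isl_def)
          then have "u \<noteq> []" using nonempty[of "Inl u"] sets by auto
          with u have "Inl (hd u) \<in> set (word b)" by (force simp: image_iff)
          then have Xf: "X b * f v \<in> J"
            unfolding X_def using ff \<open>v \<noteq> []\<close> by (intro free_prod_mult_mem) auto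
          obtain r where "prod_list (map (case_sum f g) d) = f v * r"
            using prod_list_factor[OF v, of "case_sum f g"] by auto
          then show ?thesis using mult_mem_right[OF Xf] by (simp add: mult.assoc)
        next
          case False
          have "length (filter isl as) = length (filter isl b) + length (filter isl d)"
            using splits_mset[OF bd] by (metis mset_filter size_mset size_union filter_union_mset)
          then have "2 \<le> length (filter isl d)" using False 3 by (simp add: filter_False)
          then have "prod_list (map (case_sum f g) d) \<in> J"
          proof (rule prod_list_mem2[rotated])
            fix a b assume ab: "isl a" "isl b" "a \<in> set d" "b \<in> set d"
            then obtain u v where [simp]: "a = Inl u" "b = Inl v" by (metis isl_def)
            have "u \<noteq> []" "v \<noteq> []" using nonempty[of a] nonempty[of b] ab sets by auto
            then show "case_sum f g a * case_sum f g b \<in> J" using ff by simp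
          qed
          then show ?thesis by (rule mult_mem)
        qed
        then show ?thesis using False by auto
      qed
    qed
    let ?S = "\<Sum>(b, d)\<leftarrow>tl (splits as). (- 1) ^ length b * (X b * prod_list (map (case_sum f g) d))"
    let ?D = "\<Sum>(b, d)\<leftarrow>tl (splits as). if \<forall>a\<in>set d. \<not> isl a then (- 1) ^ length b else (0::'r)"
    have "?S - ?D * M = (\<Sum>(b, d)\<leftarrow>tl (splits as). (- 1) ^ length b *
        (X b * prod_list (map (case_sum f g) d) - (if \<forall>a\<in>set d. \<not> isl a then M else 0)))"
      unfolding sum_list_mult_const[symmetric] sum_list_subtractf[symmetric]
      by (intro arg_cong[of _ _ sum_list] map_cong) (auto simp: algebra_simps)
    also have "\<dots> \<in> J" using summand by (intro sum_list_mem) (auto intro: mult_mem)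
    finally have S: "?S - ?D * M \<in> J" .
    \<comment> \<open>Some factor is a y-factor, so the signs over all removals of y-factors cancel;
      without the trivial split they add up to minus its sign.\<close>
    have D: "?D = (- 1) ^ Suc (length as)"
    proof -
      have "\<exists>a\<in>set as. \<not> isl a"
        using len alt by (cases as; cases "tl as") (auto simp: successively_Cons)
      then have "(\<Sum>(b, d)\<leftarrow>splits as. if \<forall>a\<in>set d. \<not> isl a then (- 1) ^ length b else (0::'r)) = 0"
        by (simp add: sum_splits_sign)
      then show ?thesis
        by (subst (asm) splits_hd_tl) (simp add: add_eq_0_iff)
    qed
    have "(- 1) ^ Suc (length as) * (?S - (- 1) ^ Suc (length as) * M) \<in> J"
      by (rule mult_mem[OF S[unfolded D]])
    moreover have "free_prod f g z = (- 1) ^ Suc (length as) * ?S"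
      using free_prod_rec[of z f g] len by (simp add: as_def X_def)
    moreover have "(- 1) ^ Suc (length as) * ((- 1) ^ Suc (length as) * M) = M"
      by (simp add: mult.assoc[symmetric] power_mult_distrib[symmetric] del: power_Suc)
    ultimately show ?thesis
      unfolding M_def[symmetric] by (simp add: right_diff_distrib del: power_Suc)
  qed
qed

end

section \<open>Catalan numbers and alternating subsequences\<close>

text \<open>The Catalan number is the difference of \<open>(2 * n) choose n\<close> and
  \<open>(2 * n) choose (n + 1)\<close>, so the division in its definition is exact.\<close>

lemma catalan_mult: "(n + 1) * catalan n = (2 * n) choose n"
proof -
  have "(n + 1) * ((2 * n) choose (n + 1)) = n * ((2 * n) choose n)"
    using binomial_absorption[of n "2 * n"] binomial_absorb_comp[of "2 * n" n] by auto
  then have "(n + 1) * ((2 * n choose n) - (2 * n choose (n + 1))) = (2 * n) choose n"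
    by (simp add: diff_mult_distrib2)
  then have "n + 1 dvd (2 * n) choose n" by (metis dvd_triv_left)
  then show ?thesis by (simp add: catalan_def del: mult_Suc)
qed

text \<open>Factorial form, in which consecutive summands of the telescoping sum can be
  compared.\<close>

lemma catalan_binomial:
  assumes "j \<le> p"
  shows "real (catalan j * ((p + j) choose (2 * j))) = fact (p + j) / (fact j * fact (j + 1) * fact (p - j))"
proof -
  have "real (catalan j) * real (j + 1) = fact (2 * j) / (fact j * fact j)"
    by (simp only: of_nat_mult[symmetric] mult.commute[of "catalan j"] catalan_mult)
      (simp add: binomial_fact)
  then have "real (catalan j) = fact (2 * j) / (fact j * fact (j + 1))"
    by (simp add: eq_divide_eq divide_simps mult.commute mult.left_commute)
  moreover have "real ((p + j) choose (2 * j)) = fact (p + j) / (fact (2 * j) * fact (p - j))"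
    using assms by (simp add: binomial_fact)
  ultimately show ?thesis by simp
qed

text \<open>The sum telescopes (Gosper): with \<open>t\<close> the summand,
  \<open>p (p + 1) t(j) = j (j + 1) t(j) - (j + 1) (j + 2) t(j + 1)\<close>.\<close>

lemma sum_catalan_binomial_eq_0:
  assumes "0 < p" "p \<le> n"
  shows "(\<Sum>j\<le>n. (- 1) ^ j * int (catalan j * ((p + j) choose (2 * j)))) = 0"
proof -
  define t where "t j = (- 1) ^ j * real (catalan j * ((p + j) choose (2 * j)))" for j
  have rec: "real p * (real p + 1) * t j = real j * (real j + 1) * t j - (real j + 1) * (real j + 2) * t (Suc j)" for j
  proof -
    consider "j < p" | "j = p" | "p < j" by linarith
    then show ?thesis
    proof cases
      case 1
      then obtain q where q: "p = Suc (j + q)" using less_imp_Suc_add by blast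
      \<comment> \<open>The common part of \<open>t j\<close> and \<open>t (Suc j)\<close>; dividing
        it out leaves an identity of rational functions in \<open>j\<close> and
        \<open>q\<close>.\<close>
      define w where "w = (- 1) ^ j * (fact (p + j) / (fact j * fact j * fact q) :: real)"
      have "t j = (- 1) ^ j * (fact (p + j) / (fact j * fact (j + 1) * fact (Suc q)))"
        unfolding t_def using 1 q by (subst catalan_binomial) auto
      then have t: "t j = w / ((real j + 1) * (real q + 1))"
        by (simp add: w_def algebra_simps)
      have "t (Suc j) = (- 1) ^ Suc j * (fact (Suc (p + j)) / (fact (Suc j) * fact (Suc j + 1) * fact q))"
        unfolding t_def using 1 q by (subst catalan_binomial) auto
      then have t': "t (Suc j) = - w * (real p + real j + 1) / ((real j + 1) * (real j + 1) * (real j + 2))"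
        by (simp add: w_def divide_simps) (simp add: algebra_simps)
      have nz: "real j + 1 \<noteq> 0" "real j + 2 \<noteq> 0" "real q + 1 \<noteq> 0" by linarith+
      show ?thesis
        unfolding t t' using nz q by (simp add: divide_simps) (simp add: algebra_simps)
    qed (auto simp: t_def binomial_eq_0 simp del: binomial_Suc_Suc)
  qed
  have "real p * (real p + 1) * (\<Sum>j\<le>n. t j) = (\<Sum>j\<le>n. real j * (real j + 1) * t j - real (Suc j) * (real (Suc j) + 1) * t (Suc j))"
    unfolding sum_distrib_left by (intro sum.cong refl) (subst rec, simp add: algebra_simps)
  also have "\<dots> = - real (Suc n) * (real (Suc n) + 1) * t (Suc n)"
    by (induction n) (auto simp: algebra_simps)
  \<comment> \<open>The lower end of the telescope carried the factor \<open>j = 0\<close>; the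
    upper end vanishes because \<open>p + n + 1 < 2 * n + 2\<close>.\<close>
  also have "t (Suc n) = 0" using assms by (simp add: t_def binomial_eq_0 del: binomial_Suc_Suc)
  finally have "(\<Sum>j\<le>n. t j) = 0" using assms by simp
  moreover have "(\<Sum>j\<le>n. t j) = real_of_int (\<Sum>j\<le>n. (- 1) ^ j * int (catalan j * ((p + j) choose (2 * j))))"
    by (simp add: t_def)
  ultimately show ?thesis by linarith
qed

text \<open>By Pascal's rule, passing from \<open>p\<close> to \<open>p + 1\<close> adds the
  vanishing sum above. The common bound \<open>n\<close> keeps the range fixed during the
  induction.\<close>

lemma sum_catalan_binomial_odd:
  assumes "p \<le> n"
  shows "(\<Sum>j\<le>n. (- 1) ^ j * int (catalan j * ((p + 1 + j) choose (2 * j + 1)))) = 1"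
  using assms
proof (induction p)
  case 0
  have "(\<Sum>j\<le>n. (- 1) ^ j * int (catalan j * ((0 + 1 + j) choose (2 * j + 1))))
      = (\<Sum>j\<in>{0}. (- 1) ^ j * int (catalan j * ((0 + 1 + j) choose (2 * j + 1))))"
    by (intro sum.mono_neutral_right) (auto intro!: binomial_eq_0 simp del: binomial_Suc_Suc)
  then show ?case by (simp add: catalan_def)
next
  case (Suc p)
  have "((Suc p + 1 + j) choose (2 * j + 1)) = ((Suc p + j) choose (2 * j)) + ((p + 1 + j) choose (2 * j + 1))" for j
    by simp
  then have "(\<Sum>j\<le>n. (- 1) ^ j * int (catalan j * ((Suc p + 1 + j) choose (2 * j + 1))))
      = (\<Sum>j\<le>n. (- 1) ^ j * int (catalan j * ((Suc p + j) choose (2 * j))))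
        + (\<Sum>j\<le>n. (- 1) ^ j * int (catalan j * ((p + 1 + j) choose (2 * j + 1))))"
    by (simp only: distrib_left of_nat_add sum.distrib)
  then show ?case using Suc sum_catalan_binomial_eq_0[of "Suc p" n] by simp
qed

text \<open>By Pascal's rule, passing from \<open>p\<close> to \<open>p + 1\<close> adds the odd
  sum, which is 1.\<close>

lemma sum_catalan_binomial_even:
  assumes "p \<le> n"
  shows "(\<Sum>j\<le>n. (- 1) ^ j * int (catalan j * ((p + j + 1) choose (2 * j + 2)))) = int p"
  using assms
proof (induction p)
  case (Suc p)
  have "((Suc p + j + 1) choose (2 * j + 2)) = ((p + 1 + j) choose (2 * j + 1)) + ((p + j + 1) choose (2 * j + 2))" for j
    by (simp add: add.commute)
  then have "(\<Sum>j\<le>n. (- 1) ^ j * int (catalan j * ((Suc p + j + 1) choose (2 * j + 2))))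
      = (\<Sum>j\<le>n. (- 1) ^ j * int (catalan j * ((p + 1 + j) choose (2 * j + 1))))
        + (\<Sum>j\<le>n. (- 1) ^ j * int (catalan j * ((p + j + 1) choose (2 * j + 2))))"
    by (simp only: distrib_left of_nat_add sum.distrib)
  then show ?case using Suc sum_catalan_binomial_odd[of p n] by simp
qed (auto intro!: sum.neutral binomial_eq_0 simp del: binomial_Suc_Suc)

section \<open>Coefficients and counts of alternating subsequences\<close>

text \<open>The coefficient of the product of all the single letters in the free product of an
  alternating word of length \<open>n\<close>.\<close>

definition letter_coeff :: "nat \<Rightarrow> int" where
  "letter_coeff n =
    (if n \<le> 1 then 1
     else if even n then (- 1) ^ (n div 2 - 1) * int (catalan (n div 2 - 1))
     else 0)"

text \<open>The binomials are the counts from \<open>alternating_sum_eq\<close>. Lengths 0 and 1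
  give \<open>1 - (n + 1) div 2\<close>, odd lengths from 3 on give 0, and the lengths
  \<open>2 * j + 2\<close> give \<open>n div 2\<close> by the Catalan identity.\<close>

lemma sum_letter_coeff:
  assumes "n \<le> 2 * M"
  shows "(\<Sum>l<2 * M + 2. int ((n + l) div 2 choose l) * ((- 1) ^ l * letter_coeff l))
    = (if even n then 1 else 0)"
proof -
  have split: "(\<Sum>l<2 * M + 2. h l) = h 0 + h 1 + (\<Sum>j<M. h (2 * j + 2) + h (2 * j + 3))"
    for h :: "nat \<Rightarrow> int"
    by (induction M) (auto simp: numeral_3_eq_3)
  have "(\<Sum>l<2 * M + 2. int ((n + l) div 2 choose l) * ((- 1) ^ l * letter_coeff l))
      = 1 - int ((n + 1) div 2)
        + (\<Sum>j<M. (- 1) ^ j * int (catalan j * ((n div 2 + j + 1) choose (2 * j + 2))))"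
    unfolding split by (simp add: letter_coeff_def algebra_simps numeral_3_eq_3)
  also have "(\<Sum>j<M. (- 1) ^ j * int (catalan j * ((n div 2 + j + 1) choose (2 * j + 2)))) = int (n div 2)"
  proof (cases M)
    case 0
    then show ?thesis using assms by simp
  next
    case (Suc M')
    \<comment> \<open>The Catalan identity runs up to \<open>j = M\<close>, one term beyond the
      range here; that term is zero.\<close>
    have last: "(- 1) ^ M * int (catalan M * ((n div 2 + M + 1) choose (2 * M + 2))) = 0"
      using assms by (simp del: binomial_Suc_Suc add: binomial_eq_0)
    have "n div 2 \<le> M" using assms by simp
    then show ?thesis
      using sum_catalan_binomial_even[of "n div 2" M]
      unfolding lessThan_Suc_atMost[symmetric] sum.lessThan_Suc last by simp
  qed
  finally show ?thesis by presburger
qed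

text \<open>The parameter \<open>c\<close> is the last letter kept so far. It allows the sum to be
  computed letter by letter, with \<open>h\<close> shifted whenever a letter is kept.\<close>

definition alternating_sum :: "(nat \<Rightarrow> int) \<Rightarrow> 'b \<Rightarrow> 'b list \<Rightarrow> int" where
  "alternating_sum h c xs = (\<Sum>(b, d)\<leftarrow>splits xs. if successively (\<noteq>) (c # b) then h (length b) else 0)"

lemma alternating_sum_Nil [simp]: "alternating_sum h c [] = h 0"
  by (simp add: alternating_sum_def)

lemma alternating_sum_Cons:
  "alternating_sum h c (x # xs)
    = (if x \<noteq> c then alternating_sum (h \<circ> Suc) x xs else 0) + alternating_sum h c xs"
  by (auto simp: alternating_sum_def case_prod_unfold comp_def cong: if_cong)

text \<open>The binomial counts the alternating subsequences of length \<open>l\<close> that do not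
  begin with \<open>c\<close>. Keeping the first letter leads to \<open>y # ys\<close>; skipping it
  rules out \<open>y = c\<close> as first letter and leads to \<open>ys\<close>. This is Pascal's
  rule. Beyond \<open>length xs\<close> the binomials vanish, hence the free bound
  \<open>N\<close>.\<close>

lemma alternating_sum_eq:
  fixes xs :: "bool list"
  assumes "successively (\<noteq>) (c # xs)" "length xs < N"
  shows "alternating_sum h c xs = (\<Sum>l<N. int ((length xs + l) div 2 choose l) * h l)"
  using assms
proof (induction "length xs" arbitrary: xs c h N rule: less_induct)
  case less
  consider "xs = []" | x where "xs = [x]" | x y ys where "xs = x # y # ys"
    by (cases xs rule: remdups_adj.cases) auto
  then show ?case
  proof cases
    case 1
    have "(\<Sum>l<N. int ((length xs + l) div 2 choose l) * h l) = (\<Sum>l\<in>{0}. int ((length xs + l) div 2 choose l) * h l)"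
      using less.prems 1 by (intro sum.mono_neutral_right) (auto intro!: binomial_eq_0)
    then show ?thesis using 1 by simp
  next
    case 2
    have "(\<Sum>l<N. int ((length xs + l) div 2 choose l) * h l) = (\<Sum>l\<in>{0, 1}. int ((length xs + l) div 2 choose l) * h l)"
      using less.prems 2 by (intro sum.mono_neutral_right) (auto intro!: binomial_eq_0)
    then show ?thesis using 2 less.prems by (auto simp: alternating_sum_Cons)
  next
    case 3
    then have ne: "x \<noteq> c" "y = c" and alt: "successively (\<noteq>) (x # y # ys)" "successively (\<noteq>) (c # ys)"
      using less.prems(1) by (auto simp: successively_Cons)
    obtain K where N: "N = Suc K" using less.prems by (cases N) auto
    have K: "Suc (length ys) < K" using less.prems 3 N by auto
    have "alternating_sum h c xs = alternating_sum (h \<circ> Suc) x (y # ys) + alternating_sum h c ys"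
      using 3 ne by (simp add: alternating_sum_Cons)
    also have "alternating_sum (h \<circ> Suc) x (y # ys)
        = (\<Sum>l<K. int ((length (y # ys) + l) div 2 choose l) * (h \<circ> Suc) l)"
      using 3 alt K by (intro less.hyps) auto
    also have "alternating_sum h c ys = (\<Sum>l<N. int ((length ys + l) div 2 choose l) * h l)"
      using 3 alt K N by (intro less.hyps) auto
    also have "(\<Sum>l<K. int ((length (y # ys) + l) div 2 choose l) * (h \<circ> Suc) l)
        + (\<Sum>l<N. int ((length ys + l) div 2 choose l) * h l)
        = (\<Sum>l<N. int ((length xs + l) div 2 choose l) * h l)"
      unfolding N sum.lessThan_Suc_shift 3
      by (simp add: sum.distrib[symmetric] algebra_simps)
    finally show ?thesis .
  qed
qed

lemma letter_coeff_alternating_sum: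
  fixes xs :: "bool list"
  assumes "successively (\<noteq>) (c # xs)"
  shows "alternating_sum (\<lambda>l. (- 1) ^ l * letter_coeff l) c xs = (if even (length xs) then 1 else 0)"
  using alternating_sum_eq[OF assms, of "2 * length xs + 2"] sum_letter_coeff[of "length xs" "length xs"]
  by simp

text \<open>This is the free recursion for the coefficient of the product of the letters;
  subsequences that do not alternate have coefficient 0.\<close>

lemma letter_coeff_sum_splits:
  fixes xs :: "bool list"
  assumes "successively (\<noteq>) xs" "xs \<noteq> []"
  shows "(\<Sum>(b, d)\<leftarrow>splits xs. if successively (\<noteq>) b then (- 1) ^ length b * letter_coeff (length b) else 0) = 0"
  using assms
proof (induction xs rule: remdups_adj.induct)
  case (2 x)
  then show ?case by (simp add: letter_coeff_def)
next
  case (3 x y ys)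
  let ?h = "\<lambda>l. (- 1) ^ l * letter_coeff l"
  have y: "y = (\<not> x)" using 3 by auto
  have "(\<Sum>(b, d)\<leftarrow>splits (x # y # ys). if successively (\<noteq>) b then ?h (length b) else 0)
      = alternating_sum (?h \<circ> Suc) x (y # ys)
        + (\<Sum>(b, d)\<leftarrow>splits (y # ys). if successively (\<noteq>) b then ?h (length b) else 0)"
    by (subst splits.simps(2)) (simp del: splits.simps add: alternating_sum_def case_prod_unfold comp_def cong: if_cong)
  \<comment> \<open>Subsequences starting with the first \<open>x\<close> are those of the whole
    word not starting with \<open>y\<close>, less those that lie in \<open>ys\<close>. The two words
    have lengths of the same parity, so the sums agree.\<close>
  also have "alternating_sum (?h \<circ> Suc) x (y # ys) = alternating_sum ?h y (x # y # ys) - alternating_sum ?h y ys"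
    using y by (simp add: alternating_sum_Cons)
  also have "\<dots> = 0"
    using 3 y by (subst (1 2) letter_coeff_alternating_sum) (auto simp: successively_Cons)
  also have "(\<Sum>(b, d)\<leftarrow>splits (y # ys). if successively (\<noteq>) b then ?h (length b) else 0) = 0"
    using 3 y by auto
  finally show ?case by simp
qed simp

section \<open>The coefficient of the product of the letters\<close>

fun letter_value :: "('a list \<Rightarrow> 'r) \<Rightarrow> ('a list \<Rightarrow> 'r) \<Rightarrow> 'a + 'a \<Rightarrow> 'r" where
  "letter_value f g (Inl i) = f [i]"
| "letter_value f g (Inr i) = g [i]"

text \<open>Candidate for the free product modulo all values at words of length at least 2.\<close>

definition single_letter_term ::
  "('a list \<Rightarrow> 'r) \<Rightarrow> ('a list \<Rightarrow> 'r) \<Rightarrow> ('a + 'a) list \<Rightarrow> 'r::comm_ring_1" where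
  "single_letter_term f g z =
    (if successively (\<noteq>) (map isl z)
     then of_int (letter_coeff (length z)) * prod_list (map (letter_value f g) z) else 0)"

lemma single_letter_term_long_factor:
  assumes "a \<in> set as" "2 \<le> length (factor_word a)"
  shows "single_letter_term f g (word as) = 0"
proof -
  have "\<forall>i\<in>set (factor_word a). isl i = isl a" by (cases a) auto
  moreover obtain i j r where ij: "factor_word a = i # j # r"
    using assms(2) by (cases "factor_word a" rule: remdups_adj.cases) auto
  ultimately have "isl i = isl j" by simp
  moreover obtain us vs where "as = us @ a # vs" using assms(1) by (meson split_list)
  ultimately show ?thesis
    using ij by (auto simp: single_letter_term_def successively_append_iff successively_Cons)
qed

fun letter_factor :: "'a + 'a \<Rightarrow> 'a list + 'a list" where
  "letter_factor (Inl i) = Inl [i]"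
| "letter_factor (Inr i) = Inr [i]"

lemma factor_word_letter_factor [simp]: "factor_word (letter_factor l) = [l]"
  by (cases l) auto

lemma word_letter_factor: "word (map letter_factor z) = z"
  by (induction z) auto

lemma case_sum_letter_factor: "case_sum f g (letter_factor l) = letter_value f g l"
  by (cases l) auto

lemma isl_letter_factor: "isl (letter_factor l) = isl l"
  by (cases l) auto

context ring_ideal
begin

text \<open>A long factor can be neglected in every term: outside the recursive call its value lies in
  \<open>J\<close>, and inside it the coefficient vanishes since two consecutive letters have the same label.\<close>

lemma free_prod_single_letter_mem:
  fixes z :: "('a + 'a) list"
  assumes long: "\<And>u. 2 \<le> length u \<Longrightarrow> f u \<in> J" "\<And>u. 2 \<le> length u \<Longrightarrow> g u \<in> J"
  shows "free_prod f g z - single_letter_term f g z \<in> J"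
proof (induction "length z" arbitrary: z rule: less_induct)
  case less
  define as where "as = factors z"
  have wa: "word as = z" by (simp add: as_def concat_factors)
  have nonempty: "factor_word a \<noteq> []" if "a \<in> set as" for a
    using factors_nonempty[of a z] that by (simp add: as_def)
  have case_long: "case_sum f g a \<in> J" if "2 \<le> length (factor_word a)" for a
    using that long by (cases a) auto
  let ?H = "single_letter_term f g"
  consider "as = []" | a where "as = [a]" | "2 \<le> length as"
    by (cases as rule: remdups_adj.cases) auto
  then show ?case
  proof cases
    case 1
    then have "z = []" using wa by simp
    then show ?thesis
      by (simp add: free_prod_Nil single_letter_term_def letter_coeff_def zero_mem)
  next
    case 2
    then have eq: "free_prod f g z = case_sum f g a" by (simp add: as_def free_prod_factor)
    show ?thesis
    proof (cases "2 \<le> length (factor_word a)")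
      case True
      then show ?thesis
        using eq 2 single_letter_term_long_factor[of a as f g] case_long[of a] unfolding wa by simp
    next
      case False
      then obtain l where l: "factor_word a = [l]"
        using nonempty[of a] 2 by (cases "factor_word a" rule: remdups_adj.cases) auto
      then have "case_sum f g a = letter_value f g l" by (cases a) auto
      moreover have "z = [l]" using wa 2 l by simp
      ultimately show ?thesis
        using eq by (simp add: single_letter_term_def letter_coeff_def zero_mem)
    qed
  next
    case 3
    \<comment> \<open>The recursion sum for an arbitrary functional: first the free product in it is
      exchanged for \<open>?H\<close> modulo \<open>J\<close>, then \<open>?H\<close> is shown to
      satisfy the recursion modulo \<open>J\<close>.\<close>
    let ?S = "\<lambda>X. \<Sum>(b, d)\<leftarrow>tl (splits as).
      (- 1) ^ length b * (X (word b) * prod_list (map (case_sum f g) d)) :: 'r"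
    have rec: "free_prod f g z = (- 1) ^ Suc (length as) * ?S (free_prod f g)"
      using free_prod_rec[of z f g] 3 by (simp add: as_def)
    have "?S (free_prod f g) - ?S ?H = (\<Sum>(b, d)\<leftarrow>tl (splits as).
      (- 1) ^ length b * ((free_prod f g (word b) - ?H (word b)) * prod_list (map (case_sum f g) d)))"
      unfolding sum_list_subtractf[symmetric]
      by (intro arg_cong[of _ _ sum_list] map_cong) (auto simp: algebra_simps)
    also have "\<dots> \<in> J"
    proof (intro sum_list_mem, clarify)
      fix b d assume "(b, d) \<in> set (tl (splits as))"
      then have "free_prod f g (word b) - ?H (word b) \<in> J"
        unfolding as_def by (intro less.hyps length_word_tl_split)
      then show "(- 1) ^ length b *
          ((free_prod f g (word b) - ?H (word b)) * prod_list (map (case_sum f g) d)) \<in> J"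
        by (intro mult_mem mult_mem_right)
    qed
    finally have diff: "?S (free_prod f g) - ?S ?H \<in> J" .
    have "(- 1) ^ Suc (length as) * ?S ?H - ?H z \<in> J"
    proof (cases "\<exists>a\<in>set as. 2 \<le> length (factor_word a)")
      case True
      then obtain a where a: "a \<in> set as" "2 \<le> length (factor_word a)" by blast
      have "?H (word b) * prod_list (map (case_sum f g) d) \<in> J" if "(b, d) \<in> set (tl (splits as))" for b d
      proof -
        have "a \<in> set b \<union> set d"
          using a(1) splits_set[of b d as] that tl_splits_subset[of as] by blast
        then show ?thesis
        proof
          assume "a \<in> set b"
          then have "?H (word b) = 0" using a(2) by (rule single_letter_term_long_factor)
          then show ?thesis by (simp add: zero_mem)
        next
          assume "a \<in> set d"
          then show ?thesis using case_long[OF a(2)] by (intro mult_mem prod_list_mem)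
        qed
      qed
      then have "?S ?H \<in> J" by (intro sum_list_mem) (auto intro: mult_mem)
      then show ?thesis
        using single_letter_term_long_factor[OF a, of f g] by (simp add: wa mult_mem minus_mem)
    next
      \<comment> \<open>All factors are single letters, so \<open>z\<close> alternates and
        \<open>?H\<close> satisfies the recursion exactly.\<close>
      case False
      have "as = map letter_factor z"
      proof -
        have "\<forall>a\<in>set as. \<exists>l. a = letter_factor l"
        proof
          fix a assume "a \<in> set as"
          then have "length (factor_word a) = 1" using False nonempty by (auto simp: not_le less_2_cases_iff)
          then show "\<exists>l. a = letter_factor l"
            by (cases a)
              (auto simp: length_Suc_conv intro: exI[of _ "Inl _"] exI[of _ "Inr _"])
        qed
        then obtain z' where "as = map letter_factor z'" by (metis ex_map_conv)
        then show ?thesis using wa word_letter_factor by metis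
      qed
      moreover have "successively (\<lambda>a b. isl a \<noteq> isl b) as"
        unfolding as_def by (rule factors_alternating)
      ultimately have alt: "successively (\<noteq>) (map isl z)"
        by (simp add: successively_map isl_letter_factor)
      define P where "P = prod_list (map (letter_value f g) z)"
      \<comment> \<open>The signed coefficient depends on the labels alone, and each split
        reproduces the full product \<open>P\<close>, which can be factored out.\<close>
      define C where "C b = (if successively (\<noteq>) b then (- 1) ^ length b * letter_coeff (length b) else 0)" for b :: "bool list"
      have sum_mult: "(\<Sum>(b, d)\<leftarrow>xs. of_int (h b) * P) = of_int (\<Sum>(b, d)\<leftarrow>xs. h b) * P"
        for xs :: "(('a + 'a) list \<times> ('a + 'a) list) list" and h
        by (induction xs) (auto simp: algebra_simps)
      have "(\<Sum>(b, d)\<leftarrow>splits as. (- 1) ^ length b * (?H (word b) * prod_list (map (case_sum f g) d)))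
          = (\<Sum>(b, d)\<leftarrow>splits z. of_int (C (map isl b)) * P)"
        unfolding \<open>as = map letter_factor z\<close> splits_map map_map
      proof (intro arg_cong[of _ _ sum_list] map_cong refl, clarify)
        fix b d assume bd: "(b, d) \<in> set (splits z)"
        have "prod_list (map (case_sum f g) (map letter_factor d)) = prod_list (map (letter_value f g) d)"
          by (simp add: comp_def case_sum_letter_factor)
        moreover have "prod_list (map (letter_value f g) b) * prod_list (map (letter_value f g) d) = P"
          unfolding P_def by (rule splits_prod_list[OF bd])
        ultimately show "((\<lambda>(b, d). (- 1) ^ length b * (?H (word b) * prod_list (map (case_sum f g) d)))
          \<circ> map_prod (map letter_factor) (map letter_factor)) (b, d) = of_int (C (map isl b)) * P"
          by (auto simp: word_letter_factor single_letter_term_def C_def mult.assoc simp del: map_map)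
      qed
      also have "\<dots> = of_int (\<Sum>(b, d)\<leftarrow>splits (map isl z). C b) * P"
        unfolding splits_map sum_mult by (simp add: comp_def case_prod_unfold)
      also have "(\<Sum>(b, d)\<leftarrow>splits (map isl z). C b) = 0"
        unfolding C_def using alt 3 \<open>as = map letter_factor z\<close> by (intro letter_coeff_sum_splits) auto
      finally have "(\<Sum>(b, d)\<leftarrow>splits as. (- 1) ^ length b * (?H (word b) * prod_list (map (case_sum f g) d))) = 0"
        by simp
      from sum_splits_solve[OF this] show ?thesis by (simp add: wa zero_mem)
    qed
    then have "(- 1) ^ Suc (length as) * (?S (free_prod f g) - ?S ?H)
        + ((- 1) ^ Suc (length as) * ?S ?H - ?H z) \<in> J"
      using mult_mem[OF diff] by (intro add_mem)
    then show ?thesis unfolding rec by (simp add: right_diff_distrib)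
  qed
qed

end

section \<open>Exchange of the two algebras\<close>

lemma factors_swap: "factors (map (case_sum Inr Inl) z) = map (case_sum Inr Inl) (factors z)"
  by (induction z rule: factors.induct) (auto split: list.splits sum.splits)

lemma word_swap: "word (map (case_sum Inr Inl) as) = map (case_sum Inr Inl) (word as)"
proof (induction as)
  case (Cons a as)
  then show ?case by (cases a) auto
qed simp

text \<open>The recursion treats both algebras alike: relabelling commutes with factorization and
  with splits.\<close>

lemma free_prod_swap:
  fixes f g :: "'a list \<Rightarrow> 'r::comm_ring_1"
  shows "free_prod g f (map (case_sum Inr Inl) z) = free_prod f g z"
proof (induction "length z" arbitrary: z rule: less_induct)
  case less
  have case_swap: "case_sum g f (case_sum Inr Inl a) = case_sum f g a" for a
    by (cases a) auto
  consider "factors z = []" | a where "factors z = [a]" | "2 \<le> length (factors z)"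
    by (cases "factors z" rule: remdups_adj.cases) auto
  then show ?case
  proof cases
    case 1
    then have "z = []" using concat_factors[of z] by simp
    then show ?thesis by (simp add: free_prod_Nil)
  next
    case 2
    then show ?thesis
      using case_swap by (simp add: free_prod_factor factors_swap)
  next
    case 3
    let ?sw = "map (case_sum Inr Inl) :: ('a list + 'a list) list \<Rightarrow> _"
    have tl: "tl (splits (?sw (factors z))) = map (map_prod ?sw ?sw) (tl (splits (factors z)))"
      by (simp add: splits_map map_tl)
    have "free_prod g f (map (case_sum Inr Inl) z) = (- 1) ^ Suc (length (factors z)) *
        (\<Sum>(b, d)\<leftarrow>tl (splits (factors z)). (- 1) ^ length b *
          (free_prod g f (word (?sw b)) * prod_list (map (case_sum g f) (?sw d))))"
      using 3 free_prod_rec[of "map (case_sum Inr Inl) z" g f]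
      by (simp add: factors_swap tl comp_def case_prod_unfold del: power_Suc)
    also have "(\<Sum>(b, d)\<leftarrow>tl (splits (factors z)). (- 1) ^ length b *
          (free_prod g f (word (?sw b)) * prod_list (map (case_sum g f) (?sw d))))
        = (\<Sum>(b, d)\<leftarrow>tl (splits (factors z)). (- 1) ^ length b *
          (free_prod f g (word b) * prod_list (map (case_sum f g) d)))"
    proof (intro arg_cong[of _ _ sum_list] map_cong refl, clarify)
      fix b d assume bd: "(b, d) \<in> set (tl (splits (factors z)))"
      have "map (case_sum g f) (?sw d) = map (case_sum f g) d"
        by (simp add: case_swap)
      then show "(- 1) ^ length b * (free_prod g f (word (?sw b)) * prod_list (map (case_sum g f) (?sw d)))
          = (- 1) ^ length b * (free_prod f g (word b) * prod_list (map (case_sum f g) d))"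
        by (simp only: word_swap less.hyps[OF length_word_tl_split[OF bd]])
    qed
    also note free_prod_rec[OF 3, of f g, symmetric]
    finally show ?thesis .
  qed
qed

lemma antimonotone_prod_swap:
  fixes f g :: "'a list \<Rightarrow> 'r::comm_ring_1"
  shows "antimonotone_prod f g z = monotone_prod g f (map (case_sum Inr Inl) z)"
proof -
  have "x_factors (map (case_sum Inr Inl) as) = y_factors as" "y_factors (map (case_sum Inr Inl) as) = x_factors as" for as :: "('a list + 'a list) list"
    by (induction as) (auto simp: x_factors_def y_factors_def split: sum.splits)
  then show ?thesis
    unfolding antimonotone_prod_def monotone_prod_def factors_swap by (simp add: mult.commute)
qed

lemma (in ring_ideal) free_prod_antimonotone_mem:
  fixes z :: "('a + 'a) list"
  assumes gg: "\<And>u v. u \<noteq> [] \<Longrightarrow> v \<noteq> [] \<Longrightarrow> g u * g v \<in> J"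
    and "z \<noteq> []" "\<not> isl (hd z) \<or> \<not> isl (last z)"
  shows "free_prod f g z - antimonotone_prod f g z \<in> J"
proof -
  have "isl (case_sum Inr Inl l) = (\<not> isl l)" for l :: "'a + 'a" by (cases l) auto
  then show ?thesis
    using assms free_prod_monotone_mem[of g "map (case_sum Inr Inl) z" f]
    by (simp add: free_prod_swap antimonotone_prod_swap hd_map last_map)
qed

section \<open>Generic coefficients\<close>

locale ring_hom =
  fixes \<phi> :: "'s::comm_ring_1 \<Rightarrow> 'r::comm_ring_1"
  assumes one: "\<phi> 1 = 1"
    and add: "\<phi> (x + y) = \<phi> x + \<phi> y"
    and mult: "\<phi> (x * y) = \<phi> x * \<phi> y"
begin

lemma zero: "\<phi> 0 = 0"
  using add[of 0 0] by simp

lemma minus: "\<phi> (- x) = - \<phi> x"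
  using add[of x "- x"] zero by (simp add: eq_neg_iff_add_eq_0 add.commute)

lemma power: "\<phi> (x ^ n) = \<phi> x ^ n"
  by (induction n) (auto simp: one mult)

lemma of_nat: "\<phi> (of_nat n) = of_nat n"
  by (induction n) (auto simp: zero one add)

lemma prod_list: "\<phi> (prod_list xs) = prod_list (map \<phi> xs)"
  by (induction xs) (auto simp: one mult)

lemma sum_list: "\<phi> (sum_list xs) = sum_list (map \<phi> xs)"
  by (induction xs) (auto simp: zero add)

text \<open>The recursion uses ring operations only. An identity for generic coefficients can
  therefore be specialized to given series.\<close>

lemma free_prod: "\<phi> (free_prod F G z) = free_prod (\<phi> \<circ> F) (\<phi> \<circ> G) z"
proof (induction "length z" arbitrary: z rule: less_induct)
  case less
  have case_hom: "\<phi> (case_sum F G a) = case_sum (\<phi> \<circ> F) (\<phi> \<circ> G) a" for a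
    by (cases a) auto
  have map_hom: "map \<phi> (map (case_sum F G) d) = map (case_sum (\<phi> \<circ> F) (\<phi> \<circ> G)) d" for d
    by (simp add: case_hom[unfolded comp_def] comp_def)
  consider "factors z = []" | a where "factors z = [a]" | "2 \<le> length (factors z)"
    by (cases "factors z" rule: remdups_adj.cases) auto
  then show ?case
  proof cases
    case 1
    then have "z = []" using concat_factors[of z] by simp
    then show ?thesis by (simp add: free_prod_Nil one)
  next
    case 2
    then show ?thesis by (simp add: free_prod_factor case_hom)
  next
    case 3
    have "\<phi> ((- 1) ^ length b * (free_prod F G (word b) * prod_list (map (case_sum F G) d)))
        = (- 1) ^ length b * (free_prod (\<phi> \<circ> F) (\<phi> \<circ> G) (word b) * prod_list (map (case_sum (\<phi> \<circ> F) (\<phi> \<circ> G)) d))"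
      if "(b, d) \<in> set (tl (splits (factors z)))" for b d
      using less.hyps[OF length_word_tl_split[OF that]]
      by (simp only: mult power minus one prod_list map_hom)
    then have "map \<phi> (map (\<lambda>(b, d). (- 1) ^ length b * (free_prod F G (word b) * prod_list (map (case_sum F G) d)))
          (tl (splits (factors z))))
        = map (\<lambda>(b, d). (- 1) ^ length b * (free_prod (\<phi> \<circ> F) (\<phi> \<circ> G) (word b)
            * prod_list (map (case_sum (\<phi> \<circ> F) (\<phi> \<circ> G)) d))) (tl (splits (factors z)))"
      unfolding map_map by (intro map_cong) auto
    then show ?thesis
      unfolding free_prod_rec[OF 3] mult sum_list by (simp only: power minus one)
  qed
qed

end

text \<open>The pairs of multisets serve as exponents: adding them multiplies monomials, so the
  convolution product of these maps is the product of polynomials.\<close>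

type_synonym 'a coeff_poly = "('a list multiset \<times> 'a list multiset) \<Rightarrow>\<^sub>0 int"

text \<open>The value 1 at the empty word mirrors \<open>series1\<close> and keeps the empty word
  out of all monomials.\<close>

definition coeff_var_f :: "'a list \<Rightarrow> 'a coeff_poly" where
  "coeff_var_f u = (if u = [] then 1 else Poly_Mapping.single ({#u#}, {#}) 1)"

definition coeff_var_g :: "'a list \<Rightarrow> 'a coeff_poly" where
  "coeff_var_g v = (if v = [] then 1 else Poly_Mapping.single ({#}, {#v#}) 1)"

definition coeff_eval ::
  "('a list \<Rightarrow> 'r) \<Rightarrow> ('a list \<Rightarrow> 'r) \<Rightarrow> 'a coeff_poly \<Rightarrow> 'r::comm_ring_1" where
  "coeff_eval f g p = (\<Sum>t\<in>Poly_Mapping.keys p. of_int (Poly_Mapping.lookup p t) * monomial_value f g t)"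

lemma coeff_eval_superset:
  assumes "finite T" "Poly_Mapping.keys p \<subseteq> T"
  shows "coeff_eval f g p = (\<Sum>t\<in>T. of_int (Poly_Mapping.lookup p t) * monomial_value f g t)"
  unfolding coeff_eval_def using assms by (intro sum.mono_neutral_left) (auto simp: in_keys_iff)

lemma coeff_eval_diff: "coeff_eval f g (p - q) = coeff_eval f g p - coeff_eval f g q"
proof -
  let ?T = "Poly_Mapping.keys p \<union> Poly_Mapping.keys q"
  have "Poly_Mapping.keys (p - q) \<subseteq> ?T" by (rule keys_diff)
  then show ?thesis
    using coeff_eval_superset[of ?T p f g] coeff_eval_superset[of ?T q f g] coeff_eval_superset[of ?T "p - q" f g]
    by (simp add: lookup_minus sum_subtractf left_diff_distrib)
qed

lemma coeff_eval_zero [simp]: "coeff_eval f g 0 = 0"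
  by (simp add: coeff_eval_def)

lemma coeff_eval_single: "coeff_eval f g (Poly_Mapping.single t c) = of_int c * monomial_value f g t"
  by (simp add: coeff_eval_def)

lemma monomial_value_add: "monomial_value f g (s + t) = monomial_value f g s * monomial_value f g t"
  by (cases s; cases t) (simp add: monomial_value_def ac_simps)

text \<open>Both sides are additive in \<open>p\<close> and in \<open>q\<close>, and the monomials
  with coefficient 1 generate the additive group.\<close>

lemma coeff_eval_mult: "coeff_eval f g (p * q) = coeff_eval f g p * coeff_eval f g q"
proof (induction p rule: frag_induction[OF subset_UNIV])
  case (2 s)
  show ?case
    by (induction q rule: frag_induction[OF subset_UNIV])
      (auto simp: mult_single coeff_eval_single monomial_value_add right_diff_distrib coeff_eval_diff)
qed (auto simp: left_diff_distrib coeff_eval_diff)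

interpretation coeff_eval: ring_hom "coeff_eval f g"
proof
  show "coeff_eval f g 1 = 1"
    using coeff_eval_single[of f g 0 1, unfolded single_one]
    by (simp add: monomial_value_def zero_prod_def)
  show "coeff_eval f g (p + q) = coeff_eval f g p + coeff_eval f g q" for p q
    using coeff_eval_diff[of f g p "- q"] coeff_eval_diff[of f g 0 q] by simp
qed (rule coeff_eval_mult)

lemma coeff_eval_vars:
  assumes "f \<in> series1" "g \<in> series1"
  shows "coeff_eval f g \<circ> coeff_var_f = f" "coeff_eval f g \<circ> coeff_var_g = g"
  using assms coeff_eval.one[of f g]
  by (auto simp: fun_eq_iff coeff_var_f_def coeff_var_g_def series1_def coeff_eval_single monomial_value_def)

section \<open>Monomial ideals and bidegrees\<close>

definition supported :: "('a list multiset \<times> 'a list multiset) set \<Rightarrow> 'a coeff_poly set" where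
  "supported S = {p. Poly_Mapping.keys p \<subseteq> S}"

lemma supported_ideal:
  assumes "\<And>s t. t \<in> S \<Longrightarrow> s + t \<in> S"
  shows "ring_ideal (supported S)"
proof
  fix p q r :: "'a coeff_poly"
  show "0 \<in> supported S" by (simp add: supported_def)
  show "p \<in> supported S \<Longrightarrow> q \<in> supported S \<Longrightarrow> p + q \<in> supported S"
    using keys_add[of p q] unfolding supported_def by blast
  show "p \<in> supported S \<Longrightarrow> r * p \<in> supported S"
    using keys_mult[of r p] assms unfolding supported_def by blast
qed

text \<open>The variable of a word has the length of the word as its weight. The empty word, of
  weight 0, is excluded so that each factor takes up a positive part of the degree.\<close>

definition homogeneous :: "nat \<Rightarrow> nat \<Rightarrow> 'a coeff_poly set" where
  "homogeneous i j = supported {(U, V). [] \<notin># U \<and> [] \<notin># V \<and>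
    (\<Sum>u\<in>#U. length u) = i \<and> (\<Sum>v\<in>#V. length v) = j}"

lemma homogeneous_zero: "0 \<in> homogeneous i j"
  by (simp add: homogeneous_def supported_def)

lemma homogeneous_one: "1 \<in> homogeneous 0 0"
  by (simp add: homogeneous_def supported_def zero_prod_def)

lemma homogeneous_add: "p \<in> homogeneous i j \<Longrightarrow> q \<in> homogeneous i j \<Longrightarrow> p + q \<in> homogeneous i j"
  using keys_add[of p q] unfolding homogeneous_def supported_def by blast

lemma homogeneous_minus: "p \<in> homogeneous i j \<Longrightarrow> - p \<in> homogeneous i j"
  unfolding homogeneous_def supported_def by simp

lemma homogeneous_mult:
  assumes "p \<in> homogeneous i j" "q \<in> homogeneous k l"
  shows "p * q \<in> homogeneous (i + k) (j + l)"
  using assms keys_mult[of p q] unfolding homogeneous_def supported_def by fastforce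

lemma homogeneous_sign: "p \<in> homogeneous i j \<Longrightarrow> (- 1) ^ n * p \<in> homogeneous i j"
  by (induction n) (auto intro: homogeneous_minus)

lemma homogeneous_of_nat: "p \<in> homogeneous i j \<Longrightarrow> of_nat n * p \<in> homogeneous i j"
  by (induction n) (auto simp: distrib_right intro: homogeneous_add homogeneous_zero)

lemma homogeneous_sum_list: "(\<And>x. x \<in> set xs \<Longrightarrow> h x \<in> homogeneous i j) \<Longrightarrow> (\<Sum>x\<leftarrow>xs. h x) \<in> homogeneous i j"
  by (induction xs) (auto intro: homogeneous_zero homogeneous_add)

lemma homogeneous_var_f: "coeff_var_f u \<in> homogeneous (length u) 0"
  by (simp add: coeff_var_f_def homogeneous_one) (simp add: homogeneous_def supported_def)

lemma homogeneous_var_g: "coeff_var_g u \<in> homogeneous 0 (length u)"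
  by (simp add: coeff_var_g_def homogeneous_one) (simp add: homogeneous_def supported_def)

abbreviation x_degree :: "('a + 'a) list \<Rightarrow> nat" where
  "x_degree z \<equiv> length (filter isl z)"

abbreviation y_degree :: "('a + 'a) list \<Rightarrow> nat" where
  "y_degree z \<equiv> length (filter (\<lambda>l. \<not> isl l) z)"

lemma homogeneous_factor:
  "case_sum coeff_var_f coeff_var_g a \<in> homogeneous (x_degree (factor_word a)) (y_degree (factor_word a))"
  using homogeneous_var_f homogeneous_var_g by (cases a) (auto simp: filter_map comp_def)

lemma homogeneous_factors:
  "prod_list (map (case_sum coeff_var_f coeff_var_g) as) \<in> homogeneous (x_degree (word as)) (y_degree (word as))"
  by (induction as) (auto intro: homogeneous_one homogeneous_mult homogeneous_factor)

lemma length_filter_word_splits: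
  "(b, d) \<in> set (splits as) \<Longrightarrow>
    length (filter P (word b)) + length (filter P (word d)) = length (filter P (word as))"
  by (induction as arbitrary: b d) auto

text \<open>Each split distributes the letters of \<open>z\<close> between the recursive call and
  the removed values, so all terms have the same bidegree.\<close>

lemma homogeneous_free_prod:
  "free_prod coeff_var_f coeff_var_g z \<in> homogeneous (x_degree z) (y_degree z)"
proof (induction "length z" arbitrary: z rule: less_induct)
  case less
  consider "factors z = []" | a where "factors z = [a]" | "2 \<le> length (factors z)"
    by (cases "factors z" rule: remdups_adj.cases) auto
  then show ?case
  proof cases
    case 1
    then have "z = []" using concat_factors[of z] by simp
    then show ?thesis by (simp add: free_prod_Nil homogeneous_one)
  next
    case 2
    then show ?thesis
      using homogeneous_factor[of a] concat_factors[of z] by (simp add: free_prod_factor)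
  next
    case 3
    have "free_prod coeff_var_f coeff_var_g (word b) * prod_list (map (case_sum coeff_var_f coeff_var_g) d)
        \<in> homogeneous (x_degree z) (y_degree z)" if bd: "(b, d) \<in> set (tl (splits (factors z)))" for b d
    proof -
      have "(b, d) \<in> set (splits (factors z))" using bd tl_splits_subset by blast
      from this[THEN length_filter_word_splits] show ?thesis
        using homogeneous_mult[OF less.hyps[OF length_word_tl_split[OF bd]] homogeneous_factors[of d]]
        by (simp add: concat_factors)
    qed
    then show ?thesis
      unfolding free_prod_rec[OF 3]
      by (intro homogeneous_sign homogeneous_sum_list) (auto intro: homogeneous_sign)
  qed
qed

section \<open>The convolutions on the alternating word of the co-product\<close>

lemma factors_mult_coproduct: "factors (mult_coproduct w) = concat (map (\<lambda>i. [Inl [i], Inr [i]]) w)"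
proof (induction w)
  case (Cons i w)
  then have "factors (mult_coproduct (i # w)) = Inl [i] # Inr [i] # concat (map (\<lambda>i. [Inl [i], Inr [i]]) w)"
    by (cases w) (auto simp: mult_coproduct_def)
  then show ?case by simp
qed (simp add: mult_coproduct_def)

lemma x_factors_mult_coproduct: "x_factors (factors (mult_coproduct w)) = map (\<lambda>i. [i]) w"
  by (simp add: factors_mult_coproduct x_factors_def) (induction w; simp)

lemma y_factors_mult_coproduct: "y_factors (factors (mult_coproduct w)) = map (\<lambda>i. [i]) w"
  by (simp add: factors_mult_coproduct y_factors_def) (induction w; simp)

lemma concat_singletons: "concat (map (\<lambda>i. [i]) w) = w"
  by (induction w) auto

lemma monotone_mconv_eq: "monotone_mconv f g w = f w * (\<Prod>i\<leftarrow>w. g [i])"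
  by (simp add: monotone_mconv_def monotone_prod_def x_factors_mult_coproduct
      y_factors_mult_coproduct concat_singletons comp_def)

lemma antimonotone_mconv_eq: "antimonotone_mconv f g w = (\<Prod>i\<leftarrow>w. f [i]) * g w"
  by (simp add: antimonotone_mconv_def antimonotone_prod_def x_factors_mult_coproduct
      y_factors_mult_coproduct concat_singletons comp_def)

lemma boolean_mconv_eq: "boolean_mconv f g w = (\<Prod>i\<leftarrow>w. f [i]) * (\<Prod>i\<leftarrow>w. g [i])"
  by (simp add: boolean_mconv_def boolean_prod_def x_factors_mult_coproduct
      y_factors_mult_coproduct comp_def)

lemma mult_coproduct_Nil_iff: "mult_coproduct w = [] \<longleftrightarrow> w = []"
  by (cases w) (auto simp: mult_coproduct_def)

lemma isl_hd_mult_coproduct: "w \<noteq> [] \<Longrightarrow> isl (hd (mult_coproduct w))"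
  by (cases w) (auto simp: mult_coproduct_def)

lemma isl_last_mult_coproduct: "w \<noteq> [] \<Longrightarrow> \<not> isl (last (mult_coproduct w))"
  by (cases w rule: rev_cases) (auto simp: mult_coproduct_def)

text \<open>The word of the co-product alternates and has length \<open>2 * length w\<close>, which
  makes \<open>length w - 1\<close> the Catalan index in \<open>letter_coeff\<close>.\<close>

lemma single_letter_term_mult_coproduct:
  assumes "w \<noteq> []"
  shows "single_letter_term f g (mult_coproduct w)
    = (- 1) ^ (length w - 1) * of_nat (catalan (length w - 1)) * boolean_mconv f g w"
proof -
  have "successively (\<noteq>) (map isl (mult_coproduct w)) \<and> (w \<noteq> [] \<longrightarrow> hd (map isl (mult_coproduct w)))"
    by (induction w) (auto simp: mult_coproduct_def successively_Cons)
  moreover have len: "length (mult_coproduct w) = 2 * length w"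
    by (induction w) (auto simp: mult_coproduct_def)
  moreover have "prod_list (map (letter_value f g) (mult_coproduct w)) = boolean_mconv f g w"
    unfolding boolean_mconv_eq by (induction w) (auto simp: mult_coproduct_def algebra_simps)
  moreover have "\<not> 2 * length w \<le> 1" using assms by (cases w) auto
  ultimately show ?thesis
    by (simp add: single_letter_term_def letter_coeff_def)
qed

text \<open>Choosing \<open>T\<close> and \<open>c\<close> before the series makes the mixed part
  one integer polynomial for all \<open>f\<close> and \<open>g\<close>. Length 1 is excluded: there
  the three main terms give three times \<open>f [i] * g [i]\<close>, and no monomial is
  mixed.\<close>

theorem theorem3p10:
  fixes scale :: "'k::field_char_0 \<Rightarrow> 'r::comm_ring_1 \<Rightarrow> 'r"
    and w :: "'a::finite list"
  assumes "vector_space scale"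
    and "\<And>c x y. scale c (x * y) = scale c x * y"
    and "2 \<le> length w"
  shows "\<exists>(T :: ('a list multiset \<times> 'a list multiset) set) (c :: _ \<Rightarrow> int).
    finite T \<and> T \<subseteq> mixed_monomials (length w) \<and>
    (\<forall>f \<in> series1. \<forall>g \<in> series1.
      (free_mconv f g w :: 'r) =
        monotone_mconv f g w + antimonotone_mconv f g w
        + (- 1) ^ (length w - 1) * of_nat (catalan (length w - 1)) * boolean_mconv f g w
        + (\<Sum>t\<in>T. of_int (c t) * monomial_value f g t))"
proof -
  define m where "m = length w"
  define F G :: "'a list \<Rightarrow> 'a coeff_poly" where "F = coeff_var_f" and "G = coeff_var_g"
  define P where "P = free_mconv F G w"
  define M where "M = monotone_mconv F G w"
  define A where "A = antimonotone_mconv F G w"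
  define B where "B = (- 1) ^ (m - 1) * of_nat (catalan (m - 1)) * boolean_mconv F G w"
  \<comment> \<open>The generic mixed part; its monomials and coefficients provide \<open>T\<close>
    and \<open>c\<close>.\<close>
  define p where "p = P - M - A - B"
  obtain i j w' where w: "w = i # j # w'"
    using assms(3) by (cases w rule: remdups_adj.cases) auto
  then have "w \<noteq> []" by simp
  \<comment> \<open>A monomial of bidegree \<open>(m, m)\<close> that lies in all three sets is
    mixed.\<close>
  define S1 S2 S3 :: "('a list multiset \<times> 'a list multiset) set"
    where "S1 = {(U, V). 2 \<le> size U}" and "S2 = {(U, V). 2 \<le> size V}"
      and "S3 = {(U, V). (\<exists>u\<in>#U. 2 \<le> length u) \<or> (\<exists>v\<in>#V. 2 \<le> length v)}"
  interpret I1: ring_ideal "supported S1" by (rule supported_ideal) (auto simp: S1_def)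
  interpret I2: ring_ideal "supported S2" by (rule supported_ideal) (auto simp: S2_def)
  interpret I3: ring_ideal "supported S3" by (rule supported_ideal) (force simp: S3_def)
  have FF: "F u * F v \<in> supported S1" if "u \<noteq> []" "v \<noteq> []" for u v
    using that by (simp add: F_def coeff_var_f_def mult_single supported_def S1_def)
  have GG: "G u * G v \<in> supported S2" if "u \<noteq> []" "v \<noteq> []" for u v
    using that by (simp add: G_def coeff_var_g_def mult_single supported_def S2_def)
  have F_long: "F u \<in> supported S3" and G_long: "G u \<in> supported S3" if "2 \<le> length u" for u
    using that by (auto simp: F_def coeff_var_f_def G_def coeff_var_g_def supported_def S3_def)
  have Fs: "(\<Prod>i\<leftarrow>w. F [i]) \<in> supported S1"
    unfolding w using FF[of "[i]" "[j]"] by (simp add: mult.assoc[symmetric] I1.mult_mem_right)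
  have Gs: "(\<Prod>i\<leftarrow>w. G [i]) \<in> supported S2"
    unfolding w using GG[of "[i]" "[j]"] by (simp add: mult.assoc[symmetric] I2.mult_mem_right)
  have "p \<in> supported S1"
  proof -
    have "P - M \<in> supported S1"
      unfolding P_def M_def free_mconv_def monotone_mconv_def using FF \<open>w \<noteq> []\<close>
      by (intro I1.free_prod_monotone_mem)
        (auto simp: mult_coproduct_Nil_iff isl_hd_mult_coproduct)
    \<comment> \<open>Both contain the product of all \<open>F [i]\<close>, with at least two
      letters in \<open>w\<close>.\<close>
    moreover have "A \<in> supported S1" "B \<in> supported S1"
      using Fs by (auto simp: A_def B_def antimonotone_mconv_eq boolean_mconv_eq
          intro: I1.mult_mem I1.mult_mem_right)
    ultimately show ?thesis unfolding p_def by (metis I1.diff_mem)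
  qed
  have "p \<in> supported S2"
  proof -
    have "P - A \<in> supported S2"
      unfolding P_def A_def free_mconv_def antimonotone_mconv_def using GG \<open>w \<noteq> []\<close>
      by (intro I2.free_prod_antimonotone_mem)
        (auto simp: mult_coproduct_Nil_iff isl_last_mult_coproduct)
    moreover have "M \<in> supported S2" "B \<in> supported S2"
      using Gs by (auto simp: M_def B_def monotone_mconv_eq boolean_mconv_eq intro!: I2.mult_mem)
    ultimately have "P - A - M - B \<in> supported S2" by (metis I2.diff_mem)
    then show ?thesis unfolding p_def by (simp add: algebra_simps)
  qed
  have "p \<in> supported S3"
  proof -
    have "P - single_letter_term F G (mult_coproduct w) \<in> supported S3"
      unfolding P_def free_mconv_def using F_long G_long by (rule I3.free_prod_single_letter_mem)
    then have "P - B \<in> supported S3"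
      unfolding single_letter_term_mult_coproduct[OF \<open>w \<noteq> []\<close>] B_def m_def .
    \<comment> \<open>These contain \<open>F w\<close> and \<open>G w\<close>, and \<open>w\<close>
      itself is long.\<close>
    moreover have "M \<in> supported S3" "A \<in> supported S3"
      using F_long G_long assms(3) by (auto simp: M_def A_def monotone_mconv_eq antimonotone_mconv_eq
          intro: I3.mult_mem I3.mult_mem_right)
    ultimately have "P - B - M - A \<in> supported S3" by (metis I3.diff_mem)
    then show ?thesis unfolding p_def by (simp add: algebra_simps)
  qed
  have "p \<in> homogeneous m m"
  proof -
    have "x_degree (mult_coproduct w) = m" "y_degree (mult_coproduct w) = m"
      unfolding m_def mult_coproduct_def by (induction w) auto
    then have P: "P \<in> homogeneous m m"
      using homogeneous_free_prod[of "mult_coproduct w"] by (simp add: P_def free_mconv_def F_def G_def)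
    have Fs: "(\<Prod>i\<leftarrow>u. F [i]) \<in> homogeneous (length u) 0"
      and Gs: "(\<Prod>i\<leftarrow>u. G [i]) \<in> homogeneous 0 (length u)" for u
      by (induction u)
        (auto simp: F_def G_def homogeneous_one
          dest: homogeneous_mult[OF homogeneous_var_f[of "[_]"]] homogeneous_mult[OF homogeneous_var_g[of "[_]"]])
    have "M \<in> homogeneous m m" "A \<in> homogeneous m m" "boolean_mconv F G w \<in> homogeneous m m"
      using homogeneous_mult[OF Fs[of w] Gs[of w]] homogeneous_mult[OF homogeneous_var_f[of w] Gs[of w]]
        homogeneous_mult[OF Fs[of w] homogeneous_var_g[of w]]
      by (auto simp: M_def A_def monotone_mconv_eq antimonotone_mconv_eq boolean_mconv_eq m_def F_def G_def)
    moreover from this(3) have "B \<in> homogeneous m m"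
      unfolding B_def mult.assoc by (intro homogeneous_sign homogeneous_of_nat)
    ultimately have "P + - M + - A + - B \<in> homogeneous m m"
      using P by (intro homogeneous_add homogeneous_minus)
    then show ?thesis by (simp add: p_def)
  qed
  have "Poly_Mapping.keys p \<subseteq> mixed_monomials m"
  proof clarify
    fix U V assume t: "(U, V) \<in> Poly_Mapping.keys p"
    \<comment> \<open>A second non-empty word takes up a positive part of the total length
      \<open>m\<close>.\<close>
    have short: "1 \<le> length u \<and> length u < m"
      if "2 \<le> size W" "[] \<notin># W" "(\<Sum>u\<in>#W. length u) = m" "u \<in># W" for W :: "'a list multiset" and u
    proof -
      obtain W' where W: "W = add_mset u W'" using \<open>u \<in># W\<close> by (metis mset_add)
      with \<open>2 \<le> size W\<close> obtain v W'' where "W' = add_mset v W''" by (cases W') auto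
      then have "0 < (\<Sum>u\<in>#W'. length u)" using that(2) W by auto
      then show ?thesis using that W by (auto simp: Suc_le_eq)
    qed
    have "2 \<le> size U" "2 \<le> size V" "(\<exists>u\<in>#U. 2 \<le> length u) \<or> (\<exists>v\<in>#V. 2 \<le> length v)"
      using t \<open>p \<in> supported S1\<close> \<open>p \<in> supported S2\<close> \<open>p \<in> supported S3\<close>
      by (auto simp: supported_def S1_def S2_def S3_def)
    moreover have "[] \<notin># U" "[] \<notin># V" "(\<Sum>u\<in>#U. length u) = m" "(\<Sum>v\<in>#V. length v) = m"
      using t \<open>p \<in> homogeneous m m\<close> by (auto simp: homogeneous_def supported_def)
    ultimately show "(U, V) \<in> mixed_monomials m"
      using short[of U] short[of V] by (auto simp: mixed_monomials_def)
  qed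
  moreover have "free_mconv f g w = monotone_mconv f g w + antimonotone_mconv f g w
      + (- 1) ^ (length w - 1) * of_nat (catalan (length w - 1)) * boolean_mconv f g w
      + (\<Sum>t\<in>Poly_Mapping.keys p. of_int (Poly_Mapping.lookup p t) * monomial_value f g t)"
    if "f \<in> series1" "g \<in> series1" for f g :: "'a list \<Rightarrow> 'r"
  proof -
    \<comment> \<open>Since \<open>f\<close> and \<open>g\<close> have constant term 1, evaluation
      sends the generic series to them, and it commutes with the four convolutions.\<close>
    let ?e = "coeff_eval f g"
    note vars = coeff_eval_vars[OF that]
    have F: "?e (F u) = f u" and G: "?e (G u) = g u" for u
      using vars by (auto simp: fun_eq_iff F_def G_def)
    have "?e P = free_mconv f g w"
      unfolding P_def free_mconv_def F_def G_def by (simp add: coeff_eval.free_prod vars)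
    moreover have "?e M = monotone_mconv f g w" "?e A = antimonotone_mconv f g w"
      "?e (boolean_mconv F G w) = boolean_mconv f g w"
      by (simp_all add: M_def A_def monotone_mconv_eq antimonotone_mconv_eq boolean_mconv_eq
          coeff_eval.mult coeff_eval.prod_list comp_def F G)
    moreover have "?e B = (- 1) ^ (m - 1) * of_nat (catalan (m - 1)) * ?e (boolean_mconv F G w)"
      unfolding B_def coeff_eval.mult coeff_eval.power coeff_eval.of_nat coeff_eval.minus coeff_eval.one ..
    ultimately have "?e p = free_mconv f g w - monotone_mconv f g w - antimonotone_mconv f g w
        - (- 1) ^ (m - 1) * of_nat (catalan (m - 1)) * boolean_mconv f g w"
      by (simp add: p_def coeff_eval_diff)
    then show ?thesis unfolding coeff_eval_def m_def by (simp add: algebra_simps)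
  qed
  ultimately show ?thesis unfolding m_def by (intro exI conjI ballI) auto
qed

end
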